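(* For $A\in\mathbb{R}_c^{m\times n}$, $y\in\mathbb{R}_c^m$ and $c\in\mathbb{R}_c^n$ (with $m,n\in\mathbb{N}$) let $\mathcal{S}(A,y):=\{x\in\mathbb{R}_c^n: Ax\le y\}$, where the inequality holds componentwise. Consider the maximization problem $$\max_{x\in\mathcal{S}(A,y)}c\cdot x,$$ and let $\mathrm{Opt}(A,y,c)$ be its set of maximizers. Describing all coefficients by the tuple $(A,y,c)$, the parameter space is $\mathbb{R}_c^{mn+m+n}$. Let $G:\mathbb{R}_c^{mn+m+n}\to\mathbb{R}_c^n$ be a function which outputs a maximizer for given coefficients $(A,y,c)$, i.e. $$\forall (A,y,c)\in\mathbb{R}_c^{mn+m+n}:\quad G(A,y,c)\in\mathrm{Opt}(A,y,c).$$ Then $G$ is not Banach-Mazur computable. Moreover, all functions $G^*:\mathbb{R}_c^{mn+m+n}\to\mathbb{R}_c^n$ satisfying $$\|G-G^*\|_\infty\le\alpha<\frac12$$ are also not Banach-Mazur computable.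
   Context: A function $\mathbb{N}\to\mathbb{N}$ is recursive if it is computed by a Turing machine (similarly for several arguments). A sequence of rationals $(r_k)$ is computable if there are recursive $s,p,q:\mathbb{N}\to\mathbb{N}$ such that $r_k=(-1)^{s(k)}\frac{p(k)}{q(k)}$ for all $k$; analogously for double sequences. A real number $x$ is computable if there is a computable rational sequence $(q_k)$ with $|q_k-x|\le2^{-k}$ for all $k$; $\mathbb{R}_c$ denotes the set of computable reals. A real sequence $(x_l)$ is computable if there is a computable rational double sequence $(q_{l,k})$ with $|q_{l,k}-x_l|\le2^{-k}$ for all $l,k$. These notions extend componentwise to vectors and matrices. A function $f:\mathbb{R}_c^N\to\mathbb{R}_c^M$ is Banach-Mazur computable if for every computable sequence $(a_k)$ in $\mathbb{R}_c^N$, the sequence $(f(a_k))$ is computable. $\mathrm{Opt}(A,y,c)=\{x\in\mathcal{S}(A,y): c\cdot x=\max_{x'\in\mathcal{S}(A,y)}c\cdot x'\}$. $\|G-G^*\|_\infty=\sup_{(A,y,c)\in\mathbb{R}_c^{mn+m+n}}\|G(A,y,c)-G^*(A,y,c)\|$, where $\|\cdot\|$ is the Euclidean norm on $\mathbb{R}^n$. *)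

theory Defs
  imports "HOL-Analysis.Analysis"
begin

section \<open>Turing machines and recursive functions\<close>

text \<open>
  Deterministic Turing machines with finitely many two-way infinite tapes. States and tape
  symbols are initial segments of the natural numbers; symbol 0 is the blank, symbol 1 the
  unary stroke.
\<close>

datatype head_move = Move_Left | Stay | Move_Right

record turing_machine =
  tape_count :: nat
  state_count :: nat
  symbol_count :: nat
  start_state :: nat
  halt_state :: nat
  transition :: "nat \<Rightarrow> nat list \<Rightarrow> nat \<times> nat list \<times> head_move list"

definition wf_tm :: "turing_machine \<Rightarrow> bool" where
  "wf_tm M \<longleftrightarrow>
     0 < tape_count M \<and> 2 \<le> symbol_count M \<and>
     start_state M < state_count M \<and> halt_state M < state_count M \<and>
     (\<forall>q as q' bs ms.
        q < state_count M \<and> length as = tape_count M \<and> set as \<subseteq> {..<symbol_count M} \<and>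
        transition M q as = (q', bs, ms) \<longrightarrow>
        q' < state_count M \<and> length bs = tape_count M \<and> set bs \<subseteq> {..<symbol_count M} \<and>
        length ms = tape_count M)"

text \<open>A tape is its contents together with the head position.\<close>

type_synonym tape = "(int \<Rightarrow> nat) \<times> int"

type_synonym tm_config = "nat \<times> tape list"

fun tape_read :: "tape \<Rightarrow> nat" where
  "tape_read (w, h) = w h"

fun head_shift :: "head_move \<Rightarrow> int" where
  "head_shift Move_Left = -1"
| "head_shift Stay = 0"
| "head_shift Move_Right = 1"

fun tape_act :: "tape \<Rightarrow> nat \<times> head_move \<Rightarrow> tape" where
  "tape_act (w, h) (b, mv) = (w(h := b), h + head_shift mv)"

fun tm_step :: "turing_machine \<Rightarrow> tm_config \<Rightarrow> tm_config" where
  "tm_step M (q, ts) =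
     (if q = halt_state M then (q, ts)
      else case transition M q (map tape_read ts) of
             (q', bs, ms) \<Rightarrow> (q', map2 tape_act ts (zip bs ms)))"

definition unary :: "nat \<Rightarrow> int \<Rightarrow> nat" where
  "unary x i = (if 0 \<le> i \<and> i < int x then 1 else 0)"

text \<open>The arguments are written in unary on the first tapes, one per tape.\<close>

definition tm_init :: "turing_machine \<Rightarrow> nat list \<Rightarrow> tm_config" where
  "tm_init M xs =
     (start_state M,
      map (\<lambda>j. (unary (if j < length xs then xs ! j else 0), 0)) [0..<tape_count M])"

text \<open>
  The value is read off tape 0. Halting configurations are fixed by \<^const>\<open>tm_step\<close>, so the
  value does not depend on the number of steps.
\<close>

definition tm_computes :: "turing_machine \<Rightarrow> nat \<Rightarrow> (nat list \<Rightarrow> nat) \<Rightarrow> bool" where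
  "tm_computes M d f \<longleftrightarrow>
     d \<le> tape_count M \<and>
     (\<forall>xs. length xs = d \<longrightarrow>
        (\<exists>t ts. (tm_step M ^^ t) (tm_init M xs) = (halt_state M, ts) \<and>
                fst (ts ! 0) = unary (f xs)))"

definition recursive :: "nat \<Rightarrow> (nat list \<Rightarrow> nat) \<Rightarrow> bool" where
  "recursive d f \<longleftrightarrow> (\<exists>M. wf_tm M \<and> tm_computes M d f)"

definition recursive1 :: "(nat \<Rightarrow> nat) \<Rightarrow> bool" where
  "recursive1 f \<longleftrightarrow> recursive 1 (\<lambda>xs. f (xs ! 0))"

definition recursive2 :: "(nat \<Rightarrow> nat \<Rightarrow> nat) \<Rightarrow> bool" where
  "recursive2 f \<longleftrightarrow> recursive 2 (\<lambda>xs. f (xs ! 0) (xs ! 1))"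


section \<open>Computable reals and Banach-Mazur computability\<close>

definition computable_rat_seq :: "(nat \<Rightarrow> rat) \<Rightarrow> bool" where
  "computable_rat_seq r \<longleftrightarrow>
     (\<exists>s p q. recursive1 s \<and> recursive1 p \<and> recursive1 q \<and>
        (\<forall>k. q k \<noteq> 0 \<and> r k = (-1) ^ s k * (of_nat (p k) / of_nat (q k))))"

definition computable_rat_double_seq :: "(nat \<Rightarrow> nat \<Rightarrow> rat) \<Rightarrow> bool" where
  "computable_rat_double_seq r \<longleftrightarrow>
     (\<exists>s p q. recursive2 s \<and> recursive2 p \<and> recursive2 q \<and>
        (\<forall>l k. q l k \<noteq> 0 \<and> r l k = (-1) ^ s l k * (of_nat (p l k) / of_nat (q l k))))"

definition computable_reals :: "real set" where
  "computable_reals =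
     {x. \<exists>r. computable_rat_seq r \<and> (\<forall>k. \<bar>of_rat (r k) - x\<bar> \<le> 1 / 2 ^ k)}"

definition computable_real_seq :: "(nat \<Rightarrow> real) \<Rightarrow> bool" where
  "computable_real_seq x \<longleftrightarrow>
     (\<exists>r. computable_rat_double_seq r \<and> (\<forall>l k. \<bar>of_rat (r l k) - x l\<bar> \<le> 1 / 2 ^ k))"

text \<open>
  Vectors, matrices and tuples of these are treated uniformly as elements of a Euclidean space,
  whose standard basis gives the entries.
\<close>

definition computable_points :: "'a::euclidean_space set" where
  "computable_points = {x. \<forall>b\<in>Basis. x \<bullet> b \<in> computable_reals}"

definition computable_seq :: "(nat \<Rightarrow> 'a::euclidean_space) \<Rightarrow> bool" where
  "computable_seq a \<longleftrightarrow> (\<forall>b\<in>Basis. computable_real_seq (\<lambda>l. a l \<bullet> b))"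

text \<open>Only the values of \<open>f\<close> on computable points matter.\<close>

definition banach_mazur_computable ::
    "('a::euclidean_space \<Rightarrow> 'b::euclidean_space) \<Rightarrow> bool" where
  "banach_mazur_computable f \<longleftrightarrow>
     (\<forall>a. range a \<subseteq> computable_points \<and> computable_seq a \<longrightarrow> computable_seq (\<lambda>k. f (a k)))"


section \<open>Linear programs\<close>

definition feasible :: "real^'n^'m \<Rightarrow> real^'m \<Rightarrow> (real^'n) set" where
  "feasible A y = {x \<in> computable_points. \<forall>i. (A *v x) $ i \<le> y $ i}"

text \<open>The set of points attaining the maximum; empty if the program is infeasible or unbounded.\<close>

definition Opt :: "real^'n^'m \<Rightarrow> real^'m \<Rightarrow> real^'n \<Rightarrow> (real^'n) set" where
  "Opt A y c = {x \<in> feasible A y. \<forall>x' \<in> feasible A y. c \<bullet> x' \<le> c \<bullet> x}"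

text \<open>Extended reals, since the supremum may be infinite.\<close>

definition sup_dist ::
    "('a::euclidean_space \<Rightarrow> 'b::euclidean_space) \<Rightarrow> ('a \<Rightarrow> 'b) \<Rightarrow> ereal" where
  "sup_dist f g = (SUP p\<in>computable_points. ereal (norm (f p - g p)))"

end

theory Submission
  imports Defs "HOL-Library.Nat_Bijection"
begin

text \<open>
  If the only nonzero entry of the matrix is \<open>a > 0\<close>, in column \<open>j\<close>, and \<open>y = (1, \<dots>, 1)\<close>,
  \<open>c = e\<^sub>j\<close>, then every maximizer has \<open>j\<close>-th coordinate \<open>1 / a\<close>. Let \<open>a\<^sub>l\<close> be
  \<open>1 / 2 ^ (l + t + 3)\<close> if the Turing machine with code \<open>l\<close> halts on input \<open>(l, 0)\<close> after exactly
  \<open>t\<close> steps, and \<open>0\<close> if it does not halt. Simulating the machine for \<open>k\<close> steps yields \<open>a\<^sub>l\<close> up to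
  \<open>1 / 2 ^ k\<close>, so the sequence is computable. If the images of these programs were a computable
  sequence, some machine would compute the numerators \<open>p(l, k)\<close> of rational approximations to
  their \<open>j\<close>-th coordinates. Take \<open>l\<close> to be the code of this very machine: it halts after \<open>t\<close> steps
  with output \<open>p(l, 0)\<close>, which must be about \<open>2 ^ (l + t + 3)\<close> or larger, although an output of more
  than \<open>l + t\<close> strokes cannot be written in \<open>t\<close> steps. The constant error \<open>\<alpha>\<close> is irrelevant against
  this gap.
\<close>

section \<open>Counter programs on Turing machines\<close>

datatype cmd = Skip | Inc nat | Seq cmd cmd | Loop nat cmd

text \<open>The decrement comes before the body, so that one \<open>Decr_or_goto\<close> realizes
  test and decrement together. The body may itself alter \<open>r\<close>; as such loops need not
  terminate, the semantics is a relation.\<close>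

inductive exec :: "cmd \<Rightarrow> (nat \<Rightarrow> nat) \<Rightarrow> (nat \<Rightarrow> nat) \<Rightarrow> bool" where
  Skip: "exec Skip e e"
| Inc: "exec (Inc r) e (e(r := Suc (e r)))"
| Seq: "exec P e e' \<Longrightarrow> exec Q e' e'' \<Longrightarrow> exec (Seq P Q) e e''"
| Loop_zero: "e r = 0 \<Longrightarrow> exec (Loop r P) e e"
| Loop_pos: "e r \<noteq> 0 \<Longrightarrow> exec P (e(r := e r - 1)) e' \<Longrightarrow> exec (Loop r P) e' e'' \<Longrightarrow>
    exec (Loop r P) e e''"

datatype instr = Incr nat | Decr_or_goto nat nat | Goto nat

fun csize :: "cmd \<Rightarrow> nat" where
  "csize Skip = 0"
| "csize (Inc r) = 1"
| "csize (Seq P Q) = csize P + csize Q"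
| "csize (Loop r P) = csize P + 2"

text \<open>Jump targets are absolute, hence the start address \<open>a\<close> as an argument. A
  loop exits to \<open>a + csize P + 2\<close>, just behind its back jump
  \<open>Goto a\<close>.\<close>

fun compile :: "nat \<Rightarrow> cmd \<Rightarrow> instr list" where
  "compile a Skip = []"
| "compile a (Inc r) = [Incr r]"
| "compile a (Seq P Q) = compile a P @ compile (a + csize P) Q"
| "compile a (Loop r P) =
     Decr_or_goto r (a + csize P + 2) # compile (Suc a) P @ [Goto a]"

fun regs :: "cmd \<Rightarrow> nat set" where
  "regs Skip = {}"
| "regs (Inc r) = {r}"
| "regs (Seq P Q) = regs P \<union> regs Q"
| "regs (Loop r P) = insert r (regs P)"

text \<open>The bound is inclusive because the address behind the last instruction belongs to the
  halt state, where a loop at the end of the program exits.\<close>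

fun jumps_within :: "nat \<Rightarrow> instr \<Rightarrow> bool" where
  "jumps_within b (Incr r) = True"
| "jumps_within b (Decr_or_goto r j) = (j \<le> b)"
| "jumps_within b (Goto j) = (j \<le> b)"

lemma length_compile [simp]: "length (compile a P) = csize P"
  by (induction P arbitrary: a) auto

lemma jumps_within_compile:
  "x \<in> set (compile a P) \<Longrightarrow> a + csize P \<le> b \<Longrightarrow> jumps_within b x"
proof (induction P arbitrary: a)
  case (Seq P Q)
  then show ?case by (auto simp: add.assoc)
qed fastforce+

lemma finite_regs: "finite (regs P)"
  by (induction P) auto

text \<open>
  Register \<open>r\<close> is tape \<open>r\<close>, holding \<open>unary (e r)\<close> with the head just right of the strokes. State
  \<open>2 * a\<close> is about to execute instruction \<open>a\<close>; in state \<open>2 * a + 1\<close> a decrement has moved left to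
  see whether there is a stroke. The last state moves the heads into position initially.
\<close>

definition ctrans :: "nat \<Rightarrow> instr list \<Rightarrow> nat \<Rightarrow> nat list \<Rightarrow> nat \<times> nat list \<times> head_move list" where
  "ctrans n is q as =
     (if q = 2 * length is + 1 then
        if \<forall>a\<in>set as. a = 0 then (0, as, replicate n Stay)
        else (q, as, map (\<lambda>a. if a = 0 then Stay else Move_Right) as)
      else if q = 2 * length is then (q, as, replicate n Stay)
      else case is ! (q div 2) of
        Incr r \<Rightarrow> (2 * (q div 2) + 2, as[r := 1], (replicate n Stay)[r := Move_Right])
      | Goto j \<Rightarrow> (2 * j, as, replicate n Stay)
      | Decr_or_goto r j \<Rightarrow>
          if even q then (Suc q, as, (replicate n Stay)[r := Move_Left])
          else if as ! r = 0 then (2 * j, as, (replicate n Stay)[r := Move_Right])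
          else (2 * (q div 2) + 2, as[r := 0], replicate n Stay))"

definition ctm :: "nat \<Rightarrow> instr list \<Rightarrow> turing_machine" where
  "ctm n is = \<lparr>tape_count = n, state_count = 2 * length is + 2, symbol_count = 2,
     start_state = 2 * length is + 1, halt_state = 2 * length is, transition = ctrans n is\<rparr>"

lemma ctm_simps [simp]:
  "tape_count (ctm n is) = n" "state_count (ctm n is) = 2 * length is + 2"
  "symbol_count (ctm n is) = 2" "start_state (ctm n is) = 2 * length is + 1"
  "halt_state (ctm n is) = 2 * length is" "transition (ctm n is) = ctrans n is"
  by (simp_all add: ctm_def)

lemma mem_set_list_update: "x \<in> set (as[r := a]) \<Longrightarrow> x = a \<or> x \<in> set as"
  using set_update_subset_insert by fastforce

lemma wf_ctm:
  assumes "0 < n" and j: "\<And>x. x \<in> set is \<Longrightarrow> jumps_within (length is) x"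
  shows "wf_tm (ctm n is)"
  unfolding wf_tm_def
proof (intro conjI allI impI; (elim conjE)?)
  fix q as q' bs ms
  assume q: "q < state_count (ctm n is)" and as: "length as = tape_count (ctm n is)"
    "set as \<subseteq> {..<symbol_count (ctm n is)}" and t: "transition (ctm n is) q as = (q', bs, ms)"
  have "q' < 2 * length is + 2 \<and> length bs = n \<and> set bs \<subseteq> {..<2} \<and> length ms = n"
  proof (cases "q < 2 * length is")
    case True
    then have "is ! (q div 2) \<in> set is" by auto
    from j[OF this] show ?thesis using True as t
      by (cases "is ! (q div 2)")
        (auto simp: ctrans_def dest!: mem_set_list_update split: if_splits)
  next
    case False
    then show ?thesis using q as t by (auto simp: ctrans_def split: if_splits)
  qed
  then show "q' < state_count (ctm n is)" "length bs = tape_count (ctm n is)"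
    "set bs \<subseteq> {..<symbol_count (ctm n is)}" "length ms = tape_count (ctm n is)" by auto
qed (use assms in auto)

definition ctapes :: "nat \<Rightarrow> (nat \<Rightarrow> nat) \<Rightarrow> tape list" where
  "ctapes n e = map (\<lambda>r. (unary (e r), int (e r))) [0..<n]"

definition reaches :: "turing_machine \<Rightarrow> tm_config \<Rightarrow> tm_config \<Rightarrow> bool" where
  "reaches M c d \<longleftrightarrow> (\<exists>t. (tm_step M ^^ t) c = d)"

lemma reaches_refl: "reaches M c c"
  unfolding reaches_def by (rule exI[of _ 0]) simp

lemma reaches_step: "tm_step M c = d \<Longrightarrow> reaches M c d"
  unfolding reaches_def by (rule exI[of _ 1]) simp

lemma reaches_trans [trans]: "reaches M c d \<Longrightarrow> reaches M d d' \<Longrightarrow> reaches M c d'"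
  unfolding reaches_def by (metis funpow_add comp_apply)

lemma reads_ctapes [simp]: "map tape_read (ctapes n e) = replicate n 0"
  by (simp add: ctapes_def comp_def unary_def map_replicate_const)

lemma unary_inc [simp]: "(unary x)(int x := Suc 0) = unary (Suc x)"
  by (auto simp: unary_def)

lemma unary_dec [simp]: "0 < x \<Longrightarrow> (unary x)(int x - 1 := 0) = unary (x - 1)"
  by (auto simp: unary_def)

lemma unary_beyond [simp]: "(unary x)(int x := 0) = unary x"
  by (auto simp: unary_def)

section \<open>Correctness of the compiled machine\<close>

lemma step_Incr:
  assumes "a < length is" "is ! a = Incr r" "r < n"
  shows "reaches (ctm n is) (2 * a, ctapes n e) (2 * Suc a, ctapes n (e(r := Suc (e r))))"
proof (rule reaches_step)
  have "map2 tape_act (ctapes n e) (zip ((replicate n 0)[r := 1]) ((replicate n Stay)[r := Move_Right]))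
      = ctapes n (e(r := Suc (e r)))"
    using assms(3) by (intro nth_equalityI) (auto simp: ctapes_def nth_list_update)
  then show "tm_step (ctm n is) (2 * a, ctapes n e) = (2 * Suc a, ctapes n (e(r := Suc (e r))))"
    using assms by (simp add: ctrans_def)
qed

lemma step_Goto:
  assumes "a < length is" "is ! a = Goto j"
  shows "reaches (ctm n is) (2 * a, ctapes n e) (2 * j, ctapes n e)"
proof (rule reaches_step)
  have "map2 tape_act (ctapes n e) (zip (replicate n 0) (replicate n Stay)) = ctapes n e"
    by (rule nth_equalityI) (auto simp: ctapes_def)
  then show "tm_step (ctm n is) (2 * a, ctapes n e) = (2 * j, ctapes n e)"
    using assms by (simp add: ctrans_def)
qed

lemma step_Decr:
  assumes a: "a < length is" "is ! a = Decr_or_goto r j" and r: "r < n"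
  shows "reaches (ctm n is) (2 * a, ctapes n e)
    (if e r = 0 then (2 * j, ctapes n e) else (2 * Suc a, ctapes n (e(r := e r - 1))))"
proof -
  \<comment> \<open>Between the two machine steps, head \<open>r\<close> stands on the last stroke,
    or on cell -1 if there is none. Erasing that stroke without moving, or stepping back right,
    restores the invariant of \<open>ctapes\<close>.\<close>
  define ts where "ts = (ctapes n e)[r := (unary (e r), int (e r) - 1)]"
  have "map2 tape_act (ctapes n e) (zip (replicate n 0) ((replicate n Stay)[r := Move_Left])) = ts"
    using r by (intro nth_equalityI) (auto simp: ctapes_def ts_def nth_list_update)
  then have 1: "tm_step (ctm n is) (2 * a, ctapes n e) = (Suc (2 * a), ts)"
    using a by (simp add: ctrans_def)
  have rd: "map tape_read ts = (replicate n 0)[r := if e r = 0 then 0 else 1]"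
    using r by (intro nth_equalityI) (auto simp: ctapes_def ts_def nth_list_update unary_def)
  have odd: "Suc (2 * a) \<noteq> 2 * length is" by presburger
  have "tm_step (ctm n is) (Suc (2 * a), ts) =
    (if e r = 0 then (2 * j, ctapes n e) else (2 * Suc a, ctapes n (e(r := e r - 1))))"
  proof (cases "e r = 0")
    case True
    have "map2 tape_act ts (zip (replicate n 0) ((replicate n Stay)[r := Move_Right])) = ctapes n e"
      using True r by (intro nth_equalityI) (auto simp: ctapes_def ts_def nth_list_update unary_def)
    moreover have "(replicate n 0)[r := 0] = replicate n (0 :: nat)"
      using r by (intro nth_equalityI) (auto simp: nth_list_update)
    ultimately show ?thesis
      using True a r rd odd by (simp add: ctrans_def)
  next
    case False
    have "map2 tape_act ts (zip (replicate n 0) (replicate n Stay)) = ctapes n (e(r := e r - 1))"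
      using False r
      by (intro nth_equalityI) (auto simp: ctapes_def ts_def nth_list_update of_nat_diff)
    moreover have "(replicate n 0)[r := 0] = replicate n (0 :: nat)"
      using r by (intro nth_equalityI) (auto simp: nth_list_update)
    ultimately show ?thesis
      using False a r rd odd by (simp add: ctrans_def)
  qed
  then show ?thesis by (rule reaches_trans[OF reaches_step[OF 1] reaches_step])
qed

text \<open>Induction over the execution. The whole instruction list stays fixed while
  \<open>pre\<close> and \<open>post\<close> vary, since subprograms sit at other addresses of the
  same list.\<close>

lemma reaches_exec:
  assumes "exec P e e'" "is = pre @ compile (length pre) P @ post" "regs P \<subseteq> {..<n}"
  shows "reaches (ctm n is) (2 * length pre, ctapes n e)
    (2 * (length pre + csize P), ctapes n e')"
  using assms
proof (induction arbitrary: pre post rule: exec.induct)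
  case (Skip e)
  then show ?case by (simp add: reaches_refl)
next
  case (Inc r e)
  then show ?case using step_Incr[of "length pre" "is" r n e] by (simp add: fun_upd_def)
next
  case (Seq P e e' Q e'')
  have "is = (pre @ compile (length pre) P) @
      compile (length (pre @ compile (length pre) P)) Q @ post"
    using Seq.prems by simp
  from Seq.IH(2)[OF this] Seq.prems
  have "reaches (ctm n is) (2 * (length pre + csize P), ctapes n e')
      (2 * (length pre + csize (Seq P Q)), ctapes n e'')" by (simp add: add.assoc)
  moreover have "reaches (ctm n is) (2 * length pre, ctapes n e)
      (2 * (length pre + csize P), ctapes n e')"
    using Seq.IH(1)[of pre] Seq.prems by simp
  ultimately show ?case by (rule reaches_trans[rotated])
next
  case (Loop_zero e r P)
  then show ?case
    using step_Decr[of "length pre" "is" r "length pre + csize P + 2" n e] by (simp add: add.assoc)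
next
  case (Loop_pos e r P e' e'')
  let ?a = "length pre"
  let ?pre = "pre @ [Decr_or_goto r (?a + csize P + 2)]"
  have "reaches (ctm n is) (2 * ?a, ctapes n e) (2 * Suc ?a, ctapes n (e(r := e r - 1)))"
    using step_Decr[of ?a "is" r "?a + csize P + 2" n e] Loop_pos by simp
  also have "is = ?pre @ compile (length ?pre) P @ (Goto ?a # post)"
    using Loop_pos.prems by simp
  from Loop_pos.IH(1)[OF this] Loop_pos.prems
  have "reaches (ctm n is) (2 * Suc ?a, ctapes n (e(r := e r - 1)))
      (2 * (Suc ?a + csize P), ctapes n e')" by (simp add: fun_upd_def)
  also have "reaches (ctm n is) (2 * (Suc ?a + csize P), ctapes n e') (2 * ?a, ctapes n e')"
    using Loop_pos.prems by (intro step_Goto) (auto simp: nth_append)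
  also have "reaches (ctm n is) (2 * ?a, ctapes n e') (2 * (?a + csize (Loop r P)), ctapes n e'')"
    using Loop_pos by blast
  finally show ?case .
qed

section \<open>Moving the heads behind the input\<close>

lemma not_all_zeroI: "r < length as \<Longrightarrow> as ! r \<noteq> 0 \<Longrightarrow> \<not> (\<forall>a\<in>set as. a = 0)"
  using nth_mem by blast

lemma ctrans_init:
  "\<not> (\<forall>a\<in>set as. a = 0) \<Longrightarrow> ctrans n is (2 * length is + 1) as =
    (2 * length is + 1, as, map (\<lambda>a. if a = 0 then Stay else Move_Right) as)"
  by (simp add: ctrans_def)

lemma tm_step_transition:
  "q \<noteq> halt_state M \<Longrightarrow> transition M q (map tape_read ts) = (q', bs, ms) \<Longrightarrow>
    tm_step M (q, ts) = (q', map2 tape_act ts (zip bs ms))"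
  by simp

text \<open>Each head runs right until it meets a blank and then waits for the others. Before step
  \<open>Max\<close> the head on a longest input still reads a stroke, so the machine stays in its
  initial state.\<close>

lemma reaches_init_aux:
  assumes "t \<le> Max (insert 0 (e ` {..<n}))"
  shows "reaches (ctm n is)
    (2 * length is + 1, map (\<lambda>r. (unary (e r), 0)) [0..<n])
    (2 * length is + 1, map (\<lambda>r. (unary (e r), int (min t (e r)))) [0..<n])"
  using assms
proof (induction t)
  case 0
  then show ?case by (simp add: reaches_refl)
next
  case (Suc t)
  let ?ts = "map (\<lambda>r. (unary (e r), int (min t (e r)))) [0..<n]"
  let ?as = "map (\<lambda>r. if t < e r then 1 else 0 :: nat) [0..<n]"
  have rd: "map tape_read ?ts = ?as" by (auto simp: unary_def)
  have "Max (insert 0 (e ` {..<n})) \<in> insert 0 (e ` {..<n})" by (rule Max_in) auto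
  then obtain r where "r < n" "t < e r" using Suc.prems by auto
  then have nz: "\<not> (\<forall>a\<in>set ?as. a = 0)" by (intro not_all_zeroI[of r]) simp_all
  have "map2 tape_act ?ts (zip ?as (map (\<lambda>a. if a = 0 then Stay else Move_Right) ?as)) =
      map (\<lambda>r. (unary (e r), int (min (Suc t) (e r)))) [0..<n]"
  proof (rule nth_equalityI)
    fix i assume "i < length (map2 tape_act ?ts
      (zip ?as (map (\<lambda>a. if a = 0 then Stay else Move_Right) ?as)))"
    then have "i < n" by simp
    moreover have "(unary (e i))(int t := Suc 0) = unary (e i)" if "t < e i"
      using that by (simp add: fun_eq_iff unary_def)
    ultimately show "map2 tape_act ?ts
        (zip ?as (map (\<lambda>a. if a = 0 then Stay else Move_Right) ?as)) ! i =
      map (\<lambda>r. (unary (e r), int (min (Suc t) (e r)))) [0..<n] ! i"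
      by (cases "t < e i") simp_all
  qed simp
  moreover have "transition (ctm n is) (2 * length is + 1) (map tape_read ?ts) =
      (2 * length is + 1, ?as, map (\<lambda>a. if a = 0 then Stay else Move_Right) ?as)"
    unfolding rd using ctrans_init[OF nz] by (simp only: ctm_simps)
  ultimately have "tm_step (ctm n is) (2 * length is + 1, ?ts) =
      (2 * length is + 1, map (\<lambda>r. (unary (e r), int (min (Suc t) (e r)))) [0..<n])"
    using tm_step_transition[of "2 * length is + 1" "ctm n is" ?ts] by (simp only: ctm_simps)
  from reaches_trans[OF Suc.IH reaches_step[OF this]] Suc.prems show ?case by simp
qed

lemma reaches_init:
  "reaches (ctm n is) (2 * length is + 1, map (\<lambda>r. (unary (e r), 0)) [0..<n]) (0, ctapes n e)"
proof -
  let ?t = "Max (insert 0 (e ` {..<n}))"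
  have "e r \<le> ?t" if "r < n" for r using that by (intro Max_ge) auto
  then have "map (\<lambda>r. (unary (e r), int (min ?t (e r)))) [0..<n] = ctapes n e"
    unfolding ctapes_def by (intro map_cong) (auto simp: min_absorb2)
  with reaches_init_aux[of ?t e n "is"]
  have "reaches (ctm n is) (2 * length is + 1, map (\<lambda>r. (unary (e r), 0)) [0..<n])
    (2 * length is + 1, ctapes n e)" by simp
  also have "map2 tape_act (ctapes n e) (zip (replicate n 0) (replicate n Stay)) = ctapes n e"
    by (rule nth_equalityI) (auto simp: ctapes_def)
  then have "reaches (ctm n is) (2 * length is + 1, ctapes n e) (0, ctapes n e)"
    by (intro reaches_step) (simp add: ctrans_def)
  finally show ?thesis .
qed

lemma recursive_exec:
  assumes "\<And>e. (\<forall>r\<ge>d. e r = 0) \<Longrightarrow> \<exists>e'. exec P e e' \<and> e' 0 = f (map e [0..<d])"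
  shows "recursive d f"
proof -
  \<comment> \<open>Enough tapes for the arguments and all registers of \<open>P\<close>, and at
    least one, since tape 0 carries the output.\<close>
  define n where "n = Suc (d + Max (insert 0 (regs P)))"
  have "r \<le> Max (insert 0 (regs P))" if "r \<in> regs P" for r
    using that finite_regs by (intro Max_ge) auto
  then have rg: "regs P \<subseteq> {..<n}" unfolding n_def by fastforce
  let ?is = "compile 0 P"
  have "wf_tm (ctm n ?is)"
    by (rule wf_ctm) (auto simp: n_def intro: jumps_within_compile)
  moreover have "tm_computes (ctm n ?is) d f"
    unfolding tm_computes_def
  proof (intro conjI allI impI)
    show "d \<le> tape_count (ctm n ?is)" by (simp add: n_def)
    fix xs :: "nat list" assume xs: "length xs = d"
    define e where "e = (\<lambda>r. if r < d then xs ! r else 0)"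
    obtain e' where e': "exec P e e'" "e' 0 = f (map e [0..<d])"
      using assms[of e] by (auto simp: e_def)
    have "map e [0..<d] = xs" using xs by (intro nth_equalityI) (auto simp: e_def)
    with e' have out: "e' 0 = f xs" by simp
    have "tm_init (ctm n ?is) xs = (2 * length ?is + 1, map (\<lambda>r. (unary (e r), 0)) [0..<n])"
      using xs by (simp add: tm_init_def e_def)
    then have "reaches (ctm n ?is) (tm_init (ctm n ?is) xs) (0, ctapes n e)"
      using reaches_init[of n ?is e] by simp
    also have "reaches (ctm n ?is) (0, ctapes n e) (2 * csize P, ctapes n e')"
      using reaches_exec[OF e'(1), of ?is "[]" "[]" n] rg by simp
    finally have "reaches (ctm n ?is) (tm_init (ctm n ?is) xs) (2 * csize P, ctapes n e')" .
    moreover have "fst (ctapes n e' ! 0) = unary (f xs)"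
      using out by (simp add: ctapes_def n_def nth_map del: upt_Suc)
    ultimately show "\<exists>t ts. (tm_step (ctm n ?is) ^^ t) (tm_init (ctm n ?is) xs) =
        (halt_state (ctm n ?is), ts) \<and> fst (ts ! 0) = unary (f xs)"
      unfolding reaches_def by auto
  qed
  ultimately show ?thesis unfolding recursive_def by blast
qed

section \<open>Functions computed by counter programs\<close>

text \<open>Invariant rule for counted loops: \<open>E i\<close> is the environment after
  \<open>i\<close> rounds. A round starts with the counter already decremented.\<close>

lemma exec_Loop:
  assumes "\<And>i. i < x \<Longrightarrow> exec P ((E i)(r := x - Suc i)) (E (Suc i))"
    and r: "\<And>i. i \<le> x \<Longrightarrow> E i r = x - i"
  shows "exec (Loop r P) (E 0) (E x)"
proof -
  \<comment> \<open>Induction on the number \<open>j\<close> of rounds left, as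
    \<open>Loop_pos\<close> peels off the first round and leaves the rest of the loop.\<close>
  have "j \<le> x \<Longrightarrow> exec (Loop r P) (E (x - j)) (E x)" for j
  proof (induction j)
    case 0
    then show ?case using r[of x] by (simp add: exec.Loop_zero)
  next
    case (Suc j)
    let ?i = "x - Suc j"
    have "exec P ((E ?i)(r := E ?i r - 1)) (E (x - j))"
      using assms(1)[of ?i] r[of ?i] Suc.prems by (simp add: Suc_diff_Suc)
    moreover have "E ?i r \<noteq> 0" using r[of ?i] Suc.prems by simp
    ultimately show ?case using Suc by (blast intro: exec.Loop_pos Suc_leD)
  qed
  from this[of x] show ?thesis by simp
qed

section \<open>Clearing, moving and copying registers\<close>

lemma exec_clear: "exec (Loop r Skip) e (e(r := 0))"
proof -
  have "exec (Loop r Skip) (e(r := e r - 0)) (e(r := e r - e r))"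
    by (rule exec_Loop[where E = "\<lambda>i. e(r := e r - i)"]) (auto intro: exec.Skip)
  then show ?thesis by simp
qed

lemma exec_move:
  assumes "r \<noteq> s"
  shows "exec (Loop r (Inc s)) e (e(r := 0, s := e s + e r))"
proof -
  have "exec (Loop r (Inc s)) (e(r := e r - 0, s := e s + 0)) (e(r := e r - e r, s := e s + e r))"
  proof (rule exec_Loop[where E = "\<lambda>i. e(r := e r - i, s := e s + i)"])
    fix i assume "i < e r"
    show "exec (Inc s) ((e(r := e r - i, s := e s + i))(r := e r - Suc i))
        (e(r := e r - Suc i, s := e s + Suc i))"
      using exec.Inc[of s "(e(r := e r - i, s := e s + i))(r := e r - Suc i)"] assms
      by (simp add: fun_upd_twist)
  qed (use assms in auto)
  then show ?thesis by simp
qed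

lemma exec_move_back:
  assumes "r \<noteq> s" "e' = e(r := 0, s := e r)"
  shows "exec (Seq (Loop s Skip) (Loop r (Inc s))) e e'"
  using exec.Seq[OF exec_clear[of s e] exec_move[of r s "e(s := 0)"]] assms
  by (simp add: fun_upd_twist)

text \<open>Reading a register destroys it. So \<open>r\<close> is moved into \<open>s\<close> and
  \<open>t\<close> at once, and then \<open>t\<close> is moved back.\<close>

lemma exec_copy:
  assumes "r \<noteq> s" "r \<noteq> t" "s \<noteq> t" "e t = 0" "e s = 0"
  shows "exec (Seq (Loop r (Seq (Inc s) (Inc t))) (Loop t (Inc r))) e (e(s := e r))"
proof (rule exec.Seq)
  have "exec (Loop r (Seq (Inc s) (Inc t))) (e(r := e r - 0, s := 0, t := 0))
      (e(r := e r - e r, s := e r, t := e r))"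
  proof (rule exec_Loop[where E = "\<lambda>i. e(r := e r - i, s := i, t := i)"])
    fix i assume "i < e r"
    let ?e = "(e(r := e r - i, s := i, t := i))(r := e r - Suc i)"
    have "exec (Seq (Inc s) (Inc t)) ?e (?e(s := Suc i, t := Suc i))"
      using exec.Seq[OF exec.Inc exec.Inc, of s t ?e] assms by simp
    moreover have "?e(s := Suc i, t := Suc i) = e(r := e r - Suc i, s := Suc i, t := Suc i)"
      using assms by (auto simp: fun_eq_iff)
    ultimately show "exec (Seq (Inc s) (Inc t)) ?e (e(r := e r - Suc i, s := Suc i, t := Suc i))"
      by simp
  qed (use assms in auto)
  moreover have "e(r := e r - 0, s := 0, t := 0) = e" using assms by (auto simp: fun_eq_iff)
  ultimately show "exec (Loop r (Seq (Inc s) (Inc t))) e (e(r := 0, s := e r, t := e r))" by simp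
  have "e(s := e r) = (e(r := 0, s := e r, t := e r))(t := 0, r := e r)"
    using assms by (auto simp: fun_eq_iff)
  then show "exec (Loop t (Inc r)) (e(r := 0, s := e r, t := e r)) (e(s := e r))"
    using exec_move[of t r "e(r := 0, s := e r, t := e r)"] assms by simp
qed

text \<open>
  The argument of \<open>f\<close> is an environment assigning values to variables; \<open>\<rho>\<close> says in which
  register each variable is kept. Registers from \<open>m\<close> on are free, and the value is left in \<open>m\<close>.
\<close>

definition programmable :: "((nat \<Rightarrow> nat) \<Rightarrow> nat) \<Rightarrow> bool" where
  "programmable f \<longleftrightarrow> (\<forall>\<rho> m. (\<forall>i. \<rho> i < m) \<longrightarrow>
     (\<exists>P. \<forall>e. (\<forall>r\<ge>m. e r = 0) \<longrightarrow> exec P e (e(m := f (\<lambda>i. e (\<rho> i))))))"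

lemma programmableE:
  assumes "programmable f" "\<And>i. \<rho> i < m"
  obtains P where "\<And>e. (\<And>r. r \<ge> m \<Longrightarrow> e r = 0) \<Longrightarrow> exec P e (e(m := f (\<lambda>i. e (\<rho> i))))"
  using assms unfolding programmable_def by meson

named_theorems prog

lemma programmable_var [prog]: "programmable (\<lambda>e. e i)"
  unfolding programmable_def
proof (intro allI impI)
  fix \<rho> :: "nat \<Rightarrow> nat" and m assume "\<forall>i. \<rho> i < m"
  then have *: "\<rho> i < m" by simp
  have "exec (Seq (Loop (\<rho> i) (Seq (Inc m) (Inc (Suc m)))) (Loop (Suc m) (Inc (\<rho> i)))) e
      (e(m := e (\<rho> i)))" if "\<forall>r\<ge>m. e r = 0" for e
    by (rule exec_copy) (use * that in auto)
  then show "\<exists>P. \<forall>e. (\<forall>r\<ge>m. e r = 0) \<longrightarrow> exec P e (e(m := e (\<rho> i)))" by blast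
qed

lemma programmable_zero: "programmable (\<lambda>e. 0)"
  unfolding programmable_def 
  using exec.Skip by (auto simp: fun_upd_idem intro!: exI[of _ Skip])

lemma programmable_Suc [prog]:
  assumes "programmable f" shows "programmable (\<lambda>e. Suc (f e))"
  unfolding programmable_def
proof (intro allI impI)
  fix \<rho> :: "nat \<Rightarrow> nat" and m assume "\<forall>i. \<rho> i < m"
  then obtain P where P: "\<And>e. (\<And>r. r \<ge> m \<Longrightarrow> e r = 0) \<Longrightarrow> exec P e (e(m := f (\<lambda>i. e (\<rho> i))))"
    using programmableE[OF assms] by metis
  have "exec (Seq P (Inc m)) e (e(m := Suc (f (\<lambda>i. e (\<rho> i)))))" if "\<forall>r\<ge>m. e r = 0" for e
    using exec.Seq[OF P exec.Inc[of m "e(m := f (\<lambda>i. e (\<rho> i)))"]] that by simp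
  then show "\<exists>P. \<forall>e. (\<forall>r\<ge>m. e r = 0) \<longrightarrow> exec P e (e(m := Suc (f (\<lambda>i. e (\<rho> i)))))"
    by blast
qed

lemma programmable_const [prog]: "programmable (\<lambda>e. c)"
  by (induction c) (auto intro: programmable_zero programmable_Suc)

text \<open>The assignment \<open>\<rho>\<close> of registers is arbitrary in
  \<open>programmable\<close>, so it can absorb \<open>\<sigma>\<close> without any new
  code.\<close>

lemma programmable_rename: "programmable f \<Longrightarrow> programmable (\<lambda>e. f (\<lambda>i. e (\<sigma> i)))"
  unfolding programmable_def by (intro allI impI) (rule mp, erule allE, erule allE, assumption, simp)

text \<open>Variables are de Bruijn indices: the value of \<open>f\<close> becomes variable 0 and
  the others shift up by one. It is kept in register \<open>m\<close> while \<open>g\<close>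
  computes from \<open>Suc m\<close> on; then the result is moved down to \<open>m\<close>.\<close>

lemma programmable_let:
  assumes f: "programmable f" and g: "programmable g"
  shows "programmable (\<lambda>e. g (case_nat (f e) e))"
  unfolding programmable_def
proof (intro allI impI)
  fix \<rho> :: "nat \<Rightarrow> nat" and m assume \<rho>: "\<forall>i. \<rho> i < m"
  obtain P where P: "\<And>e. (\<And>r. r \<ge> m \<Longrightarrow> e r = 0) \<Longrightarrow> exec P e (e(m := f (\<lambda>i. e (\<rho> i))))"
    using programmableE[OF f, of \<rho> m] \<rho> by metis
  let ?\<rho>' = "case_nat m \<rho>"
  have "?\<rho>' i < Suc m" for i using \<rho> by (auto simp: less_Suc_eq split: nat.split)
  then obtain Q where Q: "\<And>e. (\<And>r. r \<ge> Suc m \<Longrightarrow> e r = 0) \<Longrightarrow>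
      exec Q e (e(Suc m := g (\<lambda>i. e (?\<rho>' i))))"
    using programmableE[OF g, of ?\<rho>' "Suc m"] by metis
  let ?R = "Seq (Seq P Q) (Seq (Loop m Skip) (Loop (Suc m) (Inc m)))"
  have "exec ?R e (e(m := g (case_nat (f (\<lambda>i. e (\<rho> i))) (\<lambda>i. e (\<rho> i)))))"
    if e: "\<forall>r\<ge>m. e r = 0" for e
  proof -
    let ?e = "e(m := f (\<lambda>i. e (\<rho> i)))"
    have "exec (Seq P Q) e (?e(Suc m := g (\<lambda>i. ?e (?\<rho>' i))))"
      using e by (intro exec.Seq[OF P Q]) auto
    moreover have "(\<lambda>i. ?e (?\<rho>' i)) = case_nat (f (\<lambda>i. e (\<rho> i))) (\<lambda>i. e (\<rho> i))"
      using \<rho> by (auto simp: fun_eq_iff split: nat.split)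
    ultimately show ?thesis
      by (rule_tac exec.Seq[OF _ exec_move_back]) (use e in \<open>auto simp: fun_eq_iff\<close>)
  qed
  then show "\<exists>P. \<forall>e. (\<forall>r\<ge>m. e r = 0) \<longrightarrow>
      exec P e (e(m := g (case_nat (f (\<lambda>i. e (\<rho> i))) (\<lambda>i. e (\<rho> i)))))" by blast
qed

text \<open>In the assumption on \<open>g\<close>, variable 0 is the recursion index and variable 1
  the accumulator; parameters are therefore shifted by two.\<close>

lemma programmable_rec_nat [prog]:
  assumes f: "programmable f" and h: "programmable h"
    and g: "programmable (\<lambda>e. g (\<lambda>i. e (Suc (Suc i))) (e 0) (e (Suc 0)))"
  shows "programmable (\<lambda>e. rec_nat (f e) (g e) (h e))"
  unfolding programmable_def
proof (intro allI impI)
  fix \<rho> :: "nat \<Rightarrow> nat" and m assume \<rho>: "\<forall>i. \<rho> i < m"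
  obtain P where P: "\<And>e. (\<And>r. r \<ge> m \<Longrightarrow> e r = 0) \<Longrightarrow> exec P e (e(m := f (\<lambda>i. e (\<rho> i))))"
    using programmableE[OF f, of \<rho> m] \<rho> by metis
  have "\<rho> i < Suc m" for i using \<rho> by (simp add: less_Suc_eq)
  then obtain Q where Q: "\<And>e. (\<And>r. r \<ge> Suc m \<Longrightarrow> e r = 0) \<Longrightarrow>
      exec Q e (e(Suc m := h (\<lambda>i. e (\<rho> i))))"
    using programmableE[OF h, of \<rho> "Suc m"] by metis
  \<comment> \<open>Register \<open>m\<close> holds the accumulator, \<open>Suc m\<close> the number
    of rounds left and \<open>m + 2\<close> the index. The new value is computed in
    \<open>m + 3\<close> and moved to \<open>m\<close>.\<close>
  let ?\<rho>' = "case_nat (m + 2) (case_nat m \<rho>)"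
  have "?\<rho>' i < m + 3" for i
    using \<rho> by (auto split: nat.split intro: trans_less_add1)
  then obtain B where B: "\<And>e. (\<And>r. r \<ge> m + 3 \<Longrightarrow> e r = 0) \<Longrightarrow>
      exec B e (e(m + 3 := g (\<lambda>i. e (\<rho> i)) (e (m + 2)) (e m)))"
    using programmableE[OF g, of ?\<rho>' "m + 3"] by auto
  let ?B = "Seq (Seq B (Seq (Loop m Skip) (Loop (m + 3) (Inc m)))) (Inc (m + 2))"
  let ?R = "Seq (Seq (Seq P Q) (Loop (Suc m) ?B)) (Loop (m + 2) Skip)"
  have "exec ?R e (e(m := rec_nat (f (\<lambda>i. e (\<rho> i))) (g (\<lambda>i. e (\<rho> i))) (h (\<lambda>i. e (\<rho> i)))))"
    if e: "\<forall>r\<ge>m. e r = 0" for e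
  proof -
    let ?v = "\<lambda>i. e (\<rho> i)"
    let ?rec = "rec_nat (f ?v) (g ?v)"
    let ?E = "\<lambda>i. e(m := ?rec i, Suc m := h ?v - i, m + 2 := i)"
    have v: "\<rho> i \<noteq> m" "\<rho> i \<noteq> Suc m" "\<rho> i \<noteq> m + 2" "\<rho> i \<noteq> Suc (Suc m)" for i
      using \<rho>[rule_format, of i] by auto
    have "e(m := f ?v, Suc m := h ?v) = ?E 0" using e by (auto simp: fun_eq_iff)
    then have "exec (Seq P Q) e (?E 0)"
      using exec.Seq[OF P Q, of e] e by (simp add: v)
    moreover have "exec (Loop (Suc m) ?B) (?E 0) (?E (h ?v))"
    proof (rule exec_Loop[where E = ?E])
      fix i assume "i < h ?v"
      let ?e = "(?E i)(Suc m := h ?v - Suc i)"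
      have "exec B ?e (?e(m + 3 := ?rec (Suc i)))"
        using B[of ?e] e by (simp add: v)
      then have "exec (Seq B (Seq (Loop m Skip) (Loop (m + 3) (Inc m)))) ?e
          (?e(m := ?rec (Suc i)))"
        by (rule exec.Seq[OF _ exec_move_back]) (use e in \<open>auto simp: fun_eq_iff\<close>)
      from exec.Seq[OF this exec.Inc[of "m + 2"]]
      show "exec ?B ?e (?E (Suc i))"
        by (rule back_subst[where P = "exec _ _"]) (auto simp: fun_eq_iff)
    qed auto
    ultimately have "exec (Seq (Seq P Q) (Loop (Suc m) ?B)) e (?E (h ?v))"
      by (rule exec.Seq)
    from exec.Seq[OF this exec_clear[of "m + 2"]]
    have "exec ?R e ((?E (h ?v))(m + 2 := 0))" .
    moreover have "e (Suc m) = 0" "e (m + 2) = 0" using e by simp_all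
    then have "(?E (h ?v))(m + 2 := 0) = e(m := ?rec (h ?v))" by (simp add: fun_eq_iff)
    ultimately show ?thesis by (simp only:)
  qed
  then show "\<exists>P. \<forall>e. (\<forall>r\<ge>m. e r = 0) \<longrightarrow> exec P e (e(m :=
      rec_nat (f (\<lambda>i. e (\<rho> i))) (g (\<lambda>i. e (\<rho> i))) (h (\<lambda>i. e (\<rho> i)))))" by blast
qed

text \<open>Two nested bindings. In the proof \<open>g\<close> is bound to variable 0 first, so
  \<open>h\<close> is taken with its arguments swapped by the renaming \<open>1 - i\<close>.\<close>

lemma programmable_comp2:
  assumes "programmable (\<lambda>e. h (e 0) (e (Suc 0)))" "programmable f" "programmable g"
  shows "programmable (\<lambda>e. h (f e) (g e))"
proof -
  have "programmable (\<lambda>e. h (e (Suc 0)) (e 0))"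
    using programmable_rename[OF assms(1), of "\<lambda>i. 1 - i"] by simp
  from programmable_let[OF programmable_rename[OF assms(3), of Suc] this]
  have "programmable (\<lambda>e. h (e 0) (g (\<lambda>i. e (Suc i))))" by simp
  from programmable_let[OF assms(2) this] show ?thesis by simp
qed

lemma recursive_programmable:
  assumes "programmable F" "\<And>e. f (map e [0..<d]) = F e"
  shows "recursive d f"
proof -
  \<comment> \<open>An environment has infinitely many variables, but \<open>\<rho>\<close> must be
    bounded. All variables from \<open>d\<close> on share register \<open>d\<close>, which is zero
    just like them.\<close>
  obtain P where P: "\<And>e. (\<And>r. r \<ge> Suc d \<Longrightarrow> e r = 0) \<Longrightarrow>
      exec P e (e(Suc d := F (\<lambda>i. e (min i d))))"
    using programmableE[OF assms(1), of "\<lambda>i. min i d" "Suc d"]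
    by (metis le_imp_less_Suc min.cobounded2)
  show ?thesis
  proof (rule recursive_exec)
    fix e :: "nat \<Rightarrow> nat" assume e: "\<forall>r\<ge>d. e r = 0"
    then have "(\<lambda>i. e (min i d)) = e" by (auto simp: fun_eq_iff min_def)
    then have 1: "exec P e (e(Suc d := F e))" using P[of e] e by simp
    have "exec (Seq P (Seq (Loop 0 Skip) (Loop (Suc d) (Inc 0)))) e
      (e(Suc d := 0, 0 := F e))"
      by (rule exec.Seq[OF 1 exec_move_back]) auto
    then show "\<exists>e'. exec (Seq P (Seq (Loop 0 Skip) (Loop (Suc d) (Inc 0)))) e e' \<and>
        e' 0 = f (map e [0..<d])"
      using assms(2)[of e] by (intro exI[of _ "e(Suc d := 0, 0 := F e)"]) simp
  qed
qed

lemma recursive1_programmable: "programmable (\<lambda>e. f (e 0)) \<Longrightarrow> recursive1 f"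
  unfolding recursive1_def by (erule recursive_programmable) simp

lemma recursive2_programmable: "programmable (\<lambda>e. f (e 0) (e (Suc 0))) \<Longrightarrow> recursive2 f"
  unfolding recursive2_def by (erule recursive_programmable) (simp add: numeral_2_eq_2)

section \<open>Arithmetic and case distinctions by primitive recursion\<close>

lemma programmable_add [prog]:
  "programmable f \<Longrightarrow> programmable g \<Longrightarrow> programmable (\<lambda>e. f e + g e)"
proof -
  have "x + y = rec_nat x (\<lambda>_ a. Suc a) y" for x y :: nat by (induction y) auto
  then show "programmable f \<Longrightarrow> programmable g \<Longrightarrow> ?thesis" by (simp only:) (intro prog)
qed

lemma programmable_pred: "programmable f \<Longrightarrow> programmable (\<lambda>e. f e - 1)"
proof -
  have "x - 1 = rec_nat 0 (\<lambda>k _. k) x" for x :: nat by (cases x) auto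
  then show "programmable f \<Longrightarrow> ?thesis" by (simp only:) (intro prog)
qed

lemma programmable_diff [prog]:
  "programmable f \<Longrightarrow> programmable g \<Longrightarrow> programmable (\<lambda>e. f e - g e)"
proof -
  have eq: "rec_nat x (\<lambda>_ a. a - 1) y = x - y" for x y :: nat by (induction y) auto
  assume "programmable f" "programmable g"
  then have "programmable (\<lambda>e. rec_nat (f e) (\<lambda>_ a. a - 1) (g e))"
    by (intro prog programmable_pred)
  then show ?thesis by (simp only: eq)
qed

lemma programmable_if_zero:
  assumes "programmable f" "programmable g" "programmable h"
  shows "programmable (\<lambda>e. if f e = 0 then g e else h e)"
proof -
  have eq: "rec_nat y (\<lambda>_ _. z) x = (if x = 0 then y else z)" for x y z :: nat
    by (cases x) auto
  have "programmable (\<lambda>e. rec_nat (g e) (\<lambda>_ _. h e) (f e))"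
    using programmable_rename[OF assms(3)] by (rule programmable_rec_nat[OF assms(2,1)])
  then show ?thesis by (simp only: eq)
qed

text \<open>The truncated difference vanishes exactly if the inequality holds.\<close>

lemma programmable_if_le [prog]:
  assumes "programmable f" "programmable f'" "programmable g" "programmable h"
  shows "programmable (\<lambda>e. if f e \<le> f' e then g e else h e)"
  using programmable_if_zero[OF programmable_diff[OF assms(1,2)] assms(3,4)] by simp

lemma programmable_if_eq [prog]:
  assumes "programmable f" "programmable f'" "programmable g" "programmable h"
  shows "programmable (\<lambda>e. if f e = f' e then g e else h e)"
proof -
  have "(if f e = f' e then g e else h e) =
      (if f e \<le> f' e then if f' e \<le> f e then g e else h e else h e)" for e by auto
  then show ?thesis using assms by (simp only:) (intro prog)
qed

section \<open>Pairing\<close>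

abbreviation pair :: "nat \<Rightarrow> nat \<Rightarrow> nat" where "pair x y \<equiv> prod_encode (x, y)"

definition pfst :: "nat \<Rightarrow> nat" where "pfst n = fst (prod_decode n)"
definition psnd :: "nat \<Rightarrow> nat" where "psnd n = snd (prod_decode n)"

lemma pfst_pair [simp]: "pfst (pair x y) = x" and psnd_pair [simp]: "psnd (pair x y) = y"
  by (simp_all add: pfst_def psnd_def)

lemma pair_zero [simp]: "pair 0 0 = 0"
  by (simp add: prod_encode_def)

lemma pfst_zero [simp]: "pfst 0 = 0" and psnd_zero [simp]: "psnd 0 = 0"
  using pfst_pair[of 0 0] psnd_pair[of 0 0] by simp_all

text \<open>This is the largest \<open>k\<close> with \<open>triangle k \<le> n\<close>, in a form
  that fits \<open>rec_nat\<close>. Since \<open>pair x y\<close> is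
  \<open>triangle (x + y) + x\<close>, it recovers \<open>x + y\<close> and makes both projections
  arithmetic.\<close>

fun triangle_root :: "nat \<Rightarrow> nat" where
  "triangle_root 0 = 0"
| "triangle_root (Suc n) = (if triangle (Suc (triangle_root n)) \<le> Suc n
     then Suc (triangle_root n) else triangle_root n)"

lemma triangle_root_bounds:
  "triangle (triangle_root n) \<le> n \<and> n < triangle (Suc (triangle_root n))"
  by (induction n) auto

lemma mono_triangle: "m \<le> n \<Longrightarrow> triangle m \<le> triangle n"
  by (induction n) (auto simp: le_Suc_eq)

lemma triangle_root_pair: "triangle_root (pair x y) = x + y"
proof (rule antisym)
  let ?r = "triangle_root (pair x y)"
  have p: "pair x y = triangle (x + y) + x" by (simp add: prod_encode_def)
  show "?r \<le> x + y"
  proof (rule ccontr)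
    assume "\<not> ?r \<le> x + y"
    then have "triangle (Suc (x + y)) \<le> triangle ?r" by (intro mono_triangle) simp
    with triangle_root_bounds[of "pair x y"] p show False by simp
  qed
  show "x + y \<le> ?r"
  proof (rule ccontr)
    assume "\<not> x + y \<le> ?r"
    then have "triangle (Suc ?r) \<le> triangle (x + y)" by (intro mono_triangle) simp
    with triangle_root_bounds[of "pair x y"] p show False by simp
  qed
qed

lemma pfst_eq: "pfst n = n - triangle (triangle_root n)"
proof -
  obtain x y where "n = pair x y" by (metis prod_decode_inverse surj_pair)
  then show ?thesis by (simp add: triangle_root_pair) (simp add: prod_encode_def)
qed

lemma psnd_eq: "psnd n = triangle_root n - pfst n"
proof -
  obtain x y where "n = pair x y" by (metis prod_decode_inverse surj_pair)
  then show ?thesis by (simp add: triangle_root_pair)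
qed

lemma programmable_triangle [prog]: "programmable f \<Longrightarrow> programmable (\<lambda>e. triangle (f e))"
proof -
  have "triangle n = rec_nat 0 (\<lambda>k a. a + Suc k) n" for n by (induction n) auto
  then show "programmable f \<Longrightarrow> ?thesis" by (simp only:) (intro prog)
qed

lemma programmable_triangle_root: "programmable f \<Longrightarrow> programmable (\<lambda>e. triangle_root (f e))"
proof -
  have eq: "rec_nat 0 (\<lambda>k r. if triangle (Suc r) \<le> Suc k then Suc r else r) n =
      triangle_root n" for n
  proof (induction n)
    case (Suc n)
    show ?case unfolding triangle_root.simps old.nat.rec Suc ..
  qed simp
  assume "programmable f"
  then have "programmable (\<lambda>e. rec_nat 0
      (\<lambda>k r. if triangle (Suc r) \<le> Suc k then Suc r else r) (f e))" by (intro prog)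
  then show ?thesis by (simp only: eq)
qed

lemma programmable_pair [prog]:
  "programmable f \<Longrightarrow> programmable g \<Longrightarrow> programmable (\<lambda>e. pair (f e) (g e))"
  by (simp add: prod_encode_def) (intro prog)

lemma programmable_pfst [prog]: "programmable f \<Longrightarrow> programmable (\<lambda>e. pfst (f e))"
  unfolding pfst_eq by (intro prog programmable_triangle_root)

lemma programmable_psnd [prog]: "programmable f \<Longrightarrow> programmable (\<lambda>e. psnd (f e))"
  unfolding psnd_eq by (intro prog programmable_triangle_root)

text \<open>A number codes an infinite list that is eventually zero.\<close>

definition pdrop :: "nat \<Rightarrow> nat \<Rightarrow> nat" where "pdrop w i = rec_nat w (\<lambda>_ v. psnd v) i"

definition pnth :: "nat \<Rightarrow> nat \<Rightarrow> nat" where "pnth w i = pfst (pdrop w i)"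

lemma pdrop_Suc: "pdrop w (Suc i) = pdrop (psnd w) i"
proof -
  have "rec_nat (psnd w) (\<lambda>_ v. psnd v) i = psnd (rec_nat w (\<lambda>_ v. psnd v) i)"
    by (induction i) auto
  then show ?thesis by (simp add: pdrop_def)
qed

lemma pnth_0 [simp]: "pnth w 0 = pfst w" by (simp add: pnth_def pdrop_def)

lemma pnth_Suc [simp]: "pnth w (Suc i) = pnth (psnd w) i" by (simp add: pnth_def pdrop_Suc)

lemma pnth_zero [simp]: "pnth 0 i = 0" by (induction i) auto

lemma programmable_pnth [prog]:
  "programmable f \<Longrightarrow> programmable g \<Longrightarrow> programmable (\<lambda>e. pnth (f e) (g e))"
  unfolding pnth_def pdrop_def by (intro prog)

fun plist :: "nat list \<Rightarrow> nat" where
  "plist [] = 0"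
| "plist (x # xs) = pair x (plist xs)"

lemma pnth_plist [simp]: "i < length xs \<Longrightarrow> pnth (plist xs) i = xs ! i"
  by (induction xs arbitrary: i) (auto simp: nth_Cons split: nat.split)

text \<open>Lists grow only at the front, so the entries \<open>f 0\<close> to
  \<open>f (n - 1)\<close> are prepended from the last to the first.\<close>

definition pbuild :: "(nat \<Rightarrow> nat) \<Rightarrow> nat \<Rightarrow> nat" where
  "pbuild f n = rec_nat 0 (\<lambda>j a. pair (f (n - Suc j)) a) n"

lemma pbuild_eq: "pbuild f n = plist (map f [0..<n])"
proof -
  have "j \<le> n \<Longrightarrow> rec_nat 0 (\<lambda>j a. pair (f (n - Suc j)) a) j = plist (map f [n - j..<n])" for j
  proof (induction j)
    case (Suc j)
    then have "[n - Suc j..<n] = (n - Suc j) # [n - j..<n]"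
      by (metis Suc_diff_Suc Suc_le_lessD diff_less less_le_trans upt_conv_Cons zero_less_Suc)
    with Suc show ?case by simp
  qed simp
  from this[of n] show ?thesis by (simp add: pbuild_def)
qed

text \<open>Tabulating \<open>f\<close> up to the maximum of \<open>D\<close> puts any finite table,
  such as a transition function, into a single number.\<close>

lemma pnth_finite:
  assumes "finite D" obtains w where "\<And>i. i \<in> D \<Longrightarrow> pnth w i = f i"
proof
  fix i assume "i \<in> D"
  then have "i < Suc (Max D)" using assms by (simp add: less_Suc_eq_le)
  then show "pnth (plist (map f [0..<Suc (Max D)])) i = f i" by (simp del: upt_Suc)
qed

section \<open>Simulation of Turing machines\<close>

text \<open>
  A tape is coded by the two lists that one reads off from the head, to the left (without the
  scanned cell) and to the right.
\<close>

definition codes_tape :: "nat \<Rightarrow> tape \<Rightarrow> bool" where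
  "codes_tape x T \<longleftrightarrow> (\<forall>i. fst T (snd T + int i) = pnth (psnd x) i \<and>
     fst T (snd T - 1 - int i) = pnth (pfst x) i)"

fun move_code :: "head_move \<Rightarrow> nat" where
  "move_code Stay = 0"
| "move_code Move_Left = 1"
| "move_code Move_Right = 2"

text \<open>The two lists around the head act as stacks: a move passes one symbol from the top of
  one to the top of the other.\<close>

definition pact :: "nat \<Rightarrow> nat \<Rightarrow> nat \<Rightarrow> nat" where
  "pact x b mv =
     (if mv = 0 then pair (pfst x) (pair b (psnd (psnd x)))
      else if mv = 1 then pair (psnd (pfst x)) (pair (pfst (pfst x)) (pair b (psnd (psnd x))))
      else pair (pair b (pfst x)) (psnd (psnd x)))"

lemma codes_tape_read: "codes_tape x T \<Longrightarrow> tape_read T = pfst (psnd x)"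
  unfolding codes_tape_def by (cases T) (drule spec[of _ 0], simp)

lemma codes_tape_act:
  assumes "codes_tape x T" shows "codes_tape (pact x b (move_code mv)) (tape_act T (b, mv))"
proof -
  obtain w h where T: "T = (w, h)" by fastforce
  have R: "w (h + int i) = pnth (psnd x) i" and L: "w (h - 1 - int i) = pnth (pfst x) i" for i
    using assms by (simp_all add: codes_tape_def T)
  have R': "w (h + (1 + int i)) = pnth (psnd (psnd x)) i" for i
    using R[of "Suc i"] by (simp add: algebra_simps)
  have R'': "w (h + int i) = pnth (psnd (psnd x)) (i - 1)" if "i > 0" for i
    using R[of i] that by (cases i) simp_all
  have L': "w (h - 2 - int i) = pnth (psnd (pfst x)) i" for i
    using L[of "Suc i"] by (simp add: algebra_simps)
  show ?thesis
  proof (cases mv)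
    case Stay
    have "(w(h := b)) (h + int i) = pnth (pair b (psnd (psnd x))) i" for i
      using R' by (cases i) simp_all
    moreover have "(w(h := b)) (h - 1 - int i) = pnth (pfst x) i" for i
      using L by simp
    ultimately show ?thesis by (simp add: codes_tape_def T pact_def Stay)
  next
    case Move_Left
    have "(w(h := b)) (h - 1 + int i) = pnth (pair (pfst (pfst x)) (pair b (psnd (psnd x)))) i" for i
    proof -
      consider "i = 0" | "i = 1" | j where "i = Suc (Suc j)"
        by (metis One_nat_def old.nat.exhaust)
      then show ?thesis
        using L[of 0] by cases (simp_all add: R'[symmetric] algebra_simps)
    qed
    moreover have "(w(h := b)) (h - 2 - int i) = pnth (psnd (pfst x)) i" for i
      using L' by simp
    ultimately show ?thesis by (simp add: codes_tape_def T pact_def Move_Left)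
  next
    case Move_Right
    have "(w(h := b)) (h + 1 + int i) = pnth (psnd (psnd x)) i" for i
      using R'[of i] by (simp add: algebra_simps)
    moreover have "(w(h := b)) (h - int i) = pnth (pair b (pfst x)) i" for i
      using L by (cases i) (simp_all add: algebra_simps)
    ultimately show ?thesis by (simp add: codes_tape_def T pact_def Move_Right)
  qed
qed

text \<open>
  A machine is coded by \<open>plist [tape count, start state, halt state, transition table]\<close>, a
  configuration by the pair of its state and the list of its tapes.
\<close>

definition codes_tm :: "nat \<Rightarrow> turing_machine \<Rightarrow> bool" where
  "codes_tm l M \<longleftrightarrow> pnth l 0 = tape_count M \<and> pnth l 1 = start_state M \<and>
     pnth l 2 = halt_state M \<and>
     (\<forall>q as. q < state_count M \<and> set as \<subseteq> {..<symbol_count M} \<and> length as = tape_count M \<longrightarrow>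
        pnth (pnth l 3) (pair q (plist as)) = (case transition M q as of (q', bs, ms) \<Rightarrow>
          pair q' (plist (map2 (\<lambda>b mv. pair b (move_code mv)) bs ms))))"

text \<open>As \<open>pair 0 0 = 0\<close>, trailing zeros leave a code unchanged; lists are
  determined by their codes only among lists of equal length.\<close>

lemma plist_eq_iff: "length xs = length ys \<Longrightarrow> plist xs = plist ys \<longleftrightarrow> xs = ys"
  by (induction xs ys rule: list_induct2) auto

text \<open>The relevant arguments of \<open>transition\<close> form the finite set
  \<open>S\<close>. Their symbol lists all have the same length, so \<open>key\<close> is injective
  on \<open>S\<close> and the table can be indexed by it.\<close>

lemma ex_codes_tm: "\<exists>l. codes_tm l M"
proof -
  define S where "S = {..<state_count M} \<times>
    {as. set as \<subseteq> {..<symbol_count M} \<and> length as = tape_count M}"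
  define key where "key = (\<lambda>(q, as). pair q (plist as))"
  define val where "val = (\<lambda>(q, as). case transition M q as of (q', bs, ms) \<Rightarrow>
    pair q' (plist (map2 (\<lambda>b mv. pair b (move_code mv)) bs ms)))"
  have inj: "inj_on key S"
    by (rule inj_onI) (auto simp: S_def key_def plist_eq_iff)
  have "finite (key ` S)"
    unfolding S_def by (intro finite_imageI finite_cartesian_product finite_lists_length_eq) auto
  then obtain w where w: "\<And>i. i \<in> key ` S \<Longrightarrow> pnth w i = val (inv_into S key i)"
    using pnth_finite[of "key ` S" "\<lambda>i. val (inv_into S key i)"] by metis
  have "pnth w (key s) = val s" if "s \<in> S" for s
    using w[OF imageI[OF that]] inv_into_f_f[OF inj that] by simp
  then have "pnth w (pair q (plist as)) = val (q, as)" if "(q, as) \<in> S" for q as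
    using that by (force simp: key_def)
  then have "codes_tm (plist [tape_count M, start_state M, halt_state M, w]) M"
    by (simp add: codes_tm_def numeral_2_eq_2 numeral_3_eq_3 S_def val_def)
  then show ?thesis ..
qed

definition pentry :: "nat \<Rightarrow> nat \<Rightarrow> nat" where
  "pentry l c = pnth (pnth l 3)
     (pair (pfst c) (pbuild (\<lambda>j. pfst (psnd (pnth (psnd c) j))) (pnth l 0)))"

definition pstep :: "nat \<Rightarrow> nat \<Rightarrow> nat" where
  "pstep l c =
     (if pfst c = pnth l 2 then c
      else pair (pfst (pentry l c)) (pbuild (\<lambda>j. pact (pnth (psnd c) j)
        (pfst (pnth (psnd (pentry l c)) j)) (psnd (pnth (psnd (pentry l c)) j))) (pnth l 0)))"

text \<open>State and symbols are required to be in range, because \<open>codes_tm\<close> fixes the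
  table only there.\<close>

definition codes_conf :: "turing_machine \<Rightarrow> nat \<Rightarrow> tm_config \<Rightarrow> bool" where
  "codes_conf M c C \<longleftrightarrow> pfst c = fst C \<and> fst C < state_count M \<and> length (snd C) = tape_count M \<and>
     (\<forall>j < tape_count M. codes_tape (pnth (psnd c) j) (snd C ! j) \<and>
        (\<forall>i. fst (snd C ! j) i < symbol_count M))"

lemma tape_act_fst: "fst (tape_act T (b, mv)) = (fst T)(snd T := b)"
  by (cases T) simp

lemma tape_read_eq: "tape_read T = fst T (snd T)"
  by (cases T) simp

lemma codes_conf_step:
  assumes wf: "wf_tm M" and l: "codes_tm l M" and c: "codes_conf M c C"
  shows "codes_conf M (pstep l c) (tm_step M C)"
proof -
  obtain q ts where C: "C = (q, ts)" by fastforce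
  show ?thesis
  proof (cases "q = halt_state M")
    case True
    then show ?thesis using c l by (simp add: C pstep_def codes_conf_def codes_tm_def)
  next
    case False
    let ?n = "tape_count M" and ?as = "map tape_read ts"
    have q: "pfst c = q" "q < state_count M" and len: "length ts = ?n"
      and tape: "\<And>j. j < ?n \<Longrightarrow> codes_tape (pnth (psnd c) j) (ts ! j)"
      and sym: "\<And>j i. j < ?n \<Longrightarrow> fst (ts ! j) i < symbol_count M"
      using c by (auto simp: codes_conf_def C)
    obtain q' bs ms where tr: "transition M q ?as = (q', bs, ms)" by (metis prod_cases3)
    have "tape_read T < symbol_count M" if "T \<in> set ts" for T
      using that sym len by (metis in_set_conv_nth tape_read_eq)
    then have as: "set ?as \<subseteq> {..<symbol_count M}" "length ?as = ?n"
      using len by auto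
    have wf': "q' < state_count M" "length bs = ?n" "set bs \<subseteq> {..<symbol_count M}"
      "length ms = ?n"
      using wf[unfolded wf_tm_def] q as tr by blast+
    have "map (\<lambda>j. pfst (psnd (pnth (psnd c) j))) [0..<?n] = ?as"
      using len tape by (intro nth_equalityI) (auto simp: codes_tape_read[symmetric])
    then have entry: "pentry l c = pair q' (plist (map2 (\<lambda>b mv. pair b (move_code mv)) bs ms))"
      using l q as tr by (simp add: pentry_def pbuild_eq codes_tm_def)
    have "tm_step M C = (q', map2 tape_act ts (zip bs ms))"
      using tm_step_transition[OF False tr] by (simp add: C)
    moreover have "codes_tape (pact (pnth (psnd c) j) (bs ! j) (move_code (ms ! j)))
        (tape_act (ts ! j) (bs ! j, ms ! j))" if "j < ?n" for j
      by (rule codes_tape_act[OF tape[OF that]])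
    moreover have "bs ! j < symbol_count M" if "j < ?n" for j
      using wf' that by (metis lessThan_iff nth_mem subsetD)
    ultimately show ?thesis
      using False l q len wf' sym
      by (simp add: codes_conf_def pstep_def entry pbuild_eq tape_act_fst codes_tm_def)
  qed
qed

text \<open>The input is \<open>[l, 0]\<close>: the machine's own code and precision 0. Code 0 is a
  blank tape, so a single 0 stands for all tapes after the first.\<close>

definition pinit :: "nat \<Rightarrow> nat" where
  "pinit l = pair (pnth l 1) (pair (pair 0 (rec_nat 0 (\<lambda>_ a. pair 1 a) l)) 0)"

definition pconf :: "nat \<Rightarrow> nat \<Rightarrow> nat" where
  "pconf l t = rec_nat (pinit l) (\<lambda>_ c. pstep l c) t"

lemma codes_tape_unary: "codes_tape (pair 0 (rec_nat 0 (\<lambda>_ a. pair 1 a) n)) (unary n, 0)"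
proof -
  have "pnth (rec_nat 0 (\<lambda>_ a. pair 1 a) n) i = unary n (int i)" for i
  proof (induction n arbitrary: i)
    case (Suc n)
    then show ?case by (cases i) (simp_all add: unary_def)
  qed (simp add: unary_def)
  then show ?thesis by (simp add: codes_tape_def unary_def)
qed

lemma codes_conf_init:
  assumes "wf_tm M" "codes_tm l M" "2 \<le> tape_count M"
  shows "codes_conf M (pinit l) (tm_init M [l, 0])"
proof -
  define x where "x = rec_nat 0 (\<lambda>_ a. pair 1 a) l"
  define u where "u j = (if j < length [l, 0] then [l, 0] ! j else 0)" for j
  have x: "pinit l = pair (pnth l 1) (pair (pair 0 x) 0)" by (simp add: x_def pinit_def)
  have u: "tm_init M [l, 0] = (start_state M, map (\<lambda>j. (unary (u j), 0)) [0..<tape_count M])"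
    by (simp only: tm_init_def u_def)
  have "u 0 = l" "u (Suc j) = 0" for j by (auto simp: u_def nth_Cons split: nat.split)
  then have tape: "codes_tape (pnth (pair (pair 0 x) 0) j) (unary (u j), 0)" for j
    using codes_tape_unary[of l] codes_tape_unary[of 0] by (cases j) (simp_all add: x_def)
  have sym: "unary n i < symbol_count M" for n i
    using assms by (auto simp: unary_def wf_tm_def)
  have "start_state M < state_count M" using assms(1) unfolding wf_tm_def by blast
  moreover have "pnth l 1 = start_state M" using assms(2) unfolding codes_tm_def by blast
  ultimately show ?thesis
    unfolding codes_conf_def x u using tape sym by simp
qed

text \<open>Stated on codes alone, this is defined for every number \<open>l\<close>, including
  those that code no machine.\<close>

definition halted :: "nat \<Rightarrow> nat \<Rightarrow> bool" where
  "halted l t \<longleftrightarrow> pfst (pconf l t) = pnth l 2"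

lemma codes_conf_pconf:
  assumes "wf_tm M" "codes_tm l M" "2 \<le> tape_count M"
  shows "codes_conf M (pconf l t) ((tm_step M ^^ t) (tm_init M [l, 0]))"
proof (induction t)
  case 0
  show ?case using codes_conf_init[OF assms] by (simp add: pconf_def)
next
  case (Suc t)
  show ?case using codes_conf_step[OF assms(1,2) Suc] by (simp add: pconf_def)
qed

lemma halted_iff:
  assumes "wf_tm M" "codes_tm l M" "2 \<le> tape_count M"
  shows "halted l t \<longleftrightarrow> fst ((tm_step M ^^ t) (tm_init M [l, 0])) = halt_state M"
proof -
  have "pnth l 2 = halt_state M" using assms(2) unfolding codes_tm_def by blast
  then show ?thesis
    using codes_conf_pconf[OF assms, of t] by (simp add: halted_def codes_conf_def)
qed

section \<open>Space bound and diagonal argument\<close>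

lemma set_map2D: "z \<in> set (map2 f xs ys) \<Longrightarrow> \<exists>x\<in>set xs. \<exists>y. z = f x y"
  by (induction xs ys rule: list_induct2') auto

text \<open>Heads start at cell 0, move by at most one cell per step and write only where they
  stand; the input ends before cell \<open>l\<close>.\<close>

lemma tape_bound:
  assumes "wf_tm M" "tm_init M [l, 0] = C"
  shows "\<forall>T \<in> set (snd ((tm_step M ^^ t) C)).
    snd T \<le> int t \<and> (\<forall>i. fst T i \<noteq> 0 \<longrightarrow> i < int l + int t)"
proof (induction t)
  case 0
  have "i < int l" if "unary (if j < 2 then [l, 0] ! j else 0) i \<noteq> 0" for j i
    using that by (cases j) (auto simp: unary_def nth_Cons split: if_splits nat.splits)
  moreover have "snd C = map (\<lambda>j. (unary (if j < 2 then [l, 0] ! j else 0), 0)) [0..<tape_count M]"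
    using assms(2) by (auto simp: tm_init_def)
  ultimately show ?case by (simp del: neq0_conv)
next
  case (Suc t)
  obtain q ts where C: "(tm_step M ^^ t) C = (q, ts)" by fastforce
  show ?case
  proof (cases "q = halt_state M")
    case True
    then show ?thesis using Suc by (fastforce simp: C)
  next
    case False
    obtain q' bs ms where tr: "transition M q (map tape_read ts) = (q', bs, ms)"
      by (metis prod_cases3)
    have "snd T' \<le> int (Suc t) \<and> (\<forall>i. fst T' i \<noteq> 0 \<longrightarrow> i < int l + int (Suc t))"
      if T': "T' \<in> set (map2 tape_act ts (zip bs ms))" for T'
    proof -
      obtain T b mv where T: "T \<in> set ts" "T' = tape_act T (b, mv)"
        using set_map2D[OF T'] by (metis surj_pair)
      obtain w h where w: "T = (w, h)" by fastforce
      have "head_shift mv \<le> 1" by (cases mv) auto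
      moreover have "h \<le> int t \<and> (\<forall>i. w i \<noteq> 0 \<longrightarrow> i < int l + int t)"
        using Suc T(1) by (force simp: C w)
      ultimately show ?thesis by (fastforce simp: T(2) w)
    qed
    then show ?thesis
      using tm_step_transition[OF False tr] C by simp
  qed
qed

lemma tm_step_stable:
  assumes "fst ((tm_step M ^^ s) C) = halt_state M" "s \<le> t"
  shows "(tm_step M ^^ t) C = (tm_step M ^^ s) C"
  using assms(2)
proof (induction t rule: dec_induct)
  case (step t)
  then show ?case using assms(1) by (cases "(tm_step M ^^ s) C") simp
qed simp

text \<open>Take \<open>l\<close> to be a code of a machine for \<open>p\<close>, so that it runs on
  its own code. Its output of \<open>p l 0\<close> strokes obeys the space bound at the first
  halting time \<open>t\<close>.\<close>

lemma diagonal_machine: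
  assumes "recursive2 p"
  shows "\<exists>l t. halted l t \<and> (\<forall>s<t. \<not> halted l s) \<and> p l 0 \<le> l + t"
proof -
  obtain M where wf: "wf_tm M" and M: "tm_computes M 2 (\<lambda>xs. p (xs ! 0) (xs ! 1))"
    using assms by (auto simp: recursive2_def recursive_def)
  obtain l where l: "codes_tm l M" using ex_codes_tm by blast
  have n: "2 \<le> tape_count M" using M by (simp add: tm_computes_def)
  let ?C = "\<lambda>t. (tm_step M ^^ t) (tm_init M [l, 0])"
  have "\<exists>t ts. ?C t = (halt_state M, ts) \<and> fst (ts ! 0) = unary (p l 0)"
    using M unfolding tm_computes_def by (elim conjE) (drule spec[of _ "[l, 0]"], simp)
  then obtain u ts where u: "?C u = (halt_state M, ts)" "fst (ts ! 0) = unary (p l 0)"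
    by blast
  note halted = halted_iff[OF wf l n]
  \<comment> \<open>The run that yields the output may be given with more steps \<open>u\<close>
    than needed. Halting configurations are fixed, so the output already stands at the least halting
    time.\<close>
  define t where "t = (LEAST t. halted l t)"
  have "halted l u" using u by (simp add: halted)
  then have t: "halted l t" "\<forall>s<t. \<not> halted l s" "t \<le> u"
    unfolding t_def by (auto intro: LeastI Least_le dest: not_less_Least)
  with u have C: "?C t = (halt_state M, ts)"
    using tm_step_stable[where M = M and s = t and t = u and C = "tm_init M [l, 0]"]
    by (simp add: halted)
  have "length ts = tape_count M"
    using codes_conf_pconf[OF wf l n, of u] u by (simp add: codes_conf_def)
  then have "ts ! 0 \<in> set ts" using n by simp
  moreover have "\<forall>T\<in>set ts. \<forall>i. fst T i \<noteq> 0 \<longrightarrow> i < int l + int t"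
    using tape_bound[OF wf refl, of t l] unfolding C by simp
  ultimately have "unary (p l 0) i \<noteq> 0 \<Longrightarrow> i < int l + int t" for i
    unfolding u(2)[symmetric] by blast
  \<comment> \<open>If \<open>p l 0\<close> exceeded \<open>l + t\<close>, this cell would carry a
    stroke.\<close>
  from this[of "int (l + t)"] have "unary (p l 0) (int (l + t)) = 0" by auto
  then have "p l 0 \<le> l + t" by (simp add: unary_def split: if_splits)
  with t show ?thesis by blast
qed

text \<open>
  The denominator is doubled as long as the machine coded by \<open>l\<close> runs on \<open>[l, 0]\<close>: \<open>1 / den l k\<close>
  converges as \<open>k\<close> grows, with error at most \<open>1 / 2 ^ k\<close>, to a positive number if the machine
  halts and to zero otherwise.
\<close>

definition den :: "nat \<Rightarrow> nat \<Rightarrow> nat" where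
  "den l k = rec_nat (rec_nat 8 (\<lambda>_ d. d + d) l)
     (\<lambda>t d. if pfst (pconf l t) = pnth l 2 then d else d + d) k"

lemma den_running: "\<forall>s<k. \<not> halted l s \<Longrightarrow> den l k = 2 ^ (l + k + 3)"
proof (induction k)
  case 0
  have "rec_nat 8 (\<lambda>_ d. d + d) l = (2 :: nat) ^ (l + 3)" by (induction l) (simp_all add: power_add)
  then show ?case by (simp add: den_def)
next
  case (Suc k)
  then show ?case by (simp add: den_def halted_def power_add)
qed

lemma halted_mono: "t \<le> k \<Longrightarrow> halted l t \<Longrightarrow> halted l k"
proof (induction k rule: dec_induct)
  case (step k)
  then show ?case by (simp add: halted_def pconf_def pstep_def)
qed

lemma den_halted:
  assumes "halted l t" "\<forall>s<t. \<not> halted l s" "t \<le> k"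
  shows "den l k = 2 ^ (l + t + 3)"
  using assms(3)
proof (induction k rule: dec_induct)
  case base
  show ?case using assms(2) by (rule den_running)
next
  case (step k)
  then show ?case using halted_mono[OF step(1) assms(1)] by (simp add: den_def halted_def)
qed

section \<open>The simulation as a counter program\<close>

lemma programmable_pact [prog]:
  "programmable f \<Longrightarrow> programmable g \<Longrightarrow> programmable h \<Longrightarrow>
    programmable (\<lambda>e. pact (f e) (g e) (h e))"
  unfolding pact_def by (intro prog)

text \<open>Inside the recursion of \<open>pbuild\<close> the parameters are shifted by two. A
  \<open>let\<close> supplies the entry index \<open>n - Suc j\<close>, which shifts them once more,
  whence the renaming by three.\<close>

lemma programmable_pbuild [prog]:
  assumes "programmable (\<lambda>e. f (\<lambda>i. e (Suc i)) (e 0))" "programmable g"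
  shows "programmable (\<lambda>e. pbuild (f e) (g e))"
proof -
  have "programmable (\<lambda>e. f (\<lambda>i. e (Suc (Suc i))) (g (\<lambda>i. e (Suc (Suc i))) - Suc (e 0)))"
    using programmable_let[of "\<lambda>e. g (\<lambda>i. e (Suc (Suc i))) - Suc (e 0)"
        "\<lambda>e. f (\<lambda>i. e (Suc (Suc (Suc i)))) (e 0)"]
      programmable_rename[OF assms(1), of "case_nat 0 (\<lambda>i. Suc (Suc (Suc i)))"]
      programmable_diff[OF programmable_rename[OF assms(2)] programmable_Suc[OF programmable_var]]
    by simp
  then show ?thesis
    unfolding pbuild_def by (intro prog assms)
qed

lemma programmable_pentry [prog]:
  "programmable f \<Longrightarrow> programmable g \<Longrightarrow> programmable (\<lambda>e. pentry (f e) (g e))"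
  by (rule programmable_comp2[where h = pentry]) (unfold pentry_def, intro prog)

lemma programmable_pstep [prog]:
  "programmable f \<Longrightarrow> programmable g \<Longrightarrow> programmable (\<lambda>e. pstep (f e) (g e))"
  by (rule programmable_comp2[where h = pstep]) (unfold pstep_def, intro prog)

lemma programmable_pconf [prog]:
  "programmable f \<Longrightarrow> programmable g \<Longrightarrow> programmable (\<lambda>e. pconf (f e) (g e))"
  by (rule programmable_comp2[where h = pconf]) (unfold pconf_def pinit_def, intro prog)

lemma programmable_den:
  "programmable f \<Longrightarrow> programmable g \<Longrightarrow> programmable (\<lambda>e. den (f e) (g e))"
  by (rule programmable_comp2[where h = den]) (unfold den_def, intro prog)

section \<open>A computable sequence of reals\<close>

definition halting_real :: "nat \<Rightarrow> real" where
  "halting_real l = (if \<exists>t. halted l t then 1 / 2 ^ (l + (LEAST t. halted l t) + 3) else 0)"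

lemma halting_real_halted:
  assumes "halted l t" "\<forall>s<t. \<not> halted l s"
  shows "halting_real l = 1 / 2 ^ (l + t + 3)"
proof -
  have "(LEAST t. halted l t) = t"
    using assms by (intro Least_equality) (auto simp: not_less[symmetric])
  then show ?thesis using assms by (auto simp: halting_real_def)
qed

text \<open>Once the machine has halted, both numbers agree. Before that, both lie between 0 and
  \<open>1 / 2 ^ (l + k + 3)\<close>.\<close>

lemma den_approx: "\<bar>1 / real (den l k) - halting_real l\<bar> \<le> 1 / 2 ^ k"
proof -
  have small: "1 / 2 ^ (l + k + 3) \<le> 1 / (2 :: real) ^ k"
    by (intro divide_left_mono power_increasing) auto
  show ?thesis
  proof (cases "\<exists>t. halted l t")
    case True
    define t where "t = (LEAST t. halted l t)"
    have t: "halted l t" "\<forall>s<t. \<not> halted l s"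
      using True unfolding t_def by (auto intro: LeastI_ex dest: not_less_Least)
    show ?thesis
    proof (cases "t \<le> k")
      case True
      then show ?thesis using t by (simp add: den_halted halting_real_halted)
    next
      case False
      then have "den l k = 2 ^ (l + k + 3)" using t by (intro den_running) auto
      then have "1 / real (den l k) = 1 / 2 ^ (l + k + 3)" by simp
      moreover have "halting_real l = 1 / 2 ^ (l + t + 3)" using t by (rule halting_real_halted)
      moreover have "1 / 2 ^ (l + t + 3) \<le> 1 / (2 :: real) ^ (l + k + 3)"
        using False by (intro divide_left_mono power_increasing) auto
      moreover have "0 \<le> 1 / (2 :: real) ^ (l + t + 3)" by simp
      ultimately show ?thesis using small by linarith
    qed
  next
    case False
    then have "den l k = 2 ^ (l + k + 3)" by (intro den_running) auto
    then show ?thesis using small False by (simp add: halting_real_def del: power_add)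
  qed
qed

lemma den_pos: "den l k \<noteq> 0"
proof -
  have "rec_nat 8 (\<lambda>_ d. d + d) l \<noteq> (0 :: nat)" by (induction l) auto
  then show ?thesis unfolding den_def by (induction k) auto
qed

section \<open>From programs to computable reals, points and sequences\<close>

lemma computable_rat_seq_quotient:
  assumes "programmable (\<lambda>e. p (e 0))" "programmable (\<lambda>e. q (e 0))" "\<And>k. q k \<noteq> 0"
  shows "computable_rat_seq (\<lambda>k. of_nat (p k) / of_nat (q k))"
  unfolding computable_rat_seq_def
  by (rule exI[of _ "\<lambda>_. 0"], rule exI[of _ p], rule exI[of _ q])
    (simp add: assms recursive1_programmable programmable_const)

lemma computable_rat_double_seq_quotient:
  assumes "programmable (\<lambda>e. p (e 0) (e (Suc 0)))" "programmable (\<lambda>e. q (e 0) (e (Suc 0)))"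
    "\<And>l k. q l k \<noteq> 0"
  shows "computable_rat_double_seq (\<lambda>l k. of_nat (p l k) / of_nat (q l k))"
  unfolding computable_rat_double_seq_def
  by (rule exI[of _ "\<lambda>_ _. 0"], rule exI[of _ p], rule exI[of _ q])
    (simp add: assms recursive2_programmable programmable_const)

lemma computable_real_seq_halting_real: "computable_real_seq halting_real"
proof -
  have "computable_rat_double_seq (\<lambda>l k. of_nat 1 / of_nat (den l k))"
    by (rule computable_rat_double_seq_quotient)
      (intro programmable_den programmable_var programmable_const den_pos)+
  then show ?thesis
    unfolding computable_real_seq_def
    by (rule exI[of _ "\<lambda>l k. of_nat 1 / of_nat (den l k)", OF conjI])
      (simp add: den_approx of_rat_divide)
qed

lemma halting_real_computable: "halting_real l \<in> computable_reals"
proof -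
  have "computable_rat_seq (\<lambda>k. of_nat 1 / of_nat (den l k))"
    by (rule computable_rat_seq_quotient)
      (intro programmable_den programmable_var programmable_const den_pos)+
  then show ?thesis
    unfolding computable_reals_def mem_Collect_eq
    by (rule exI[of _ "\<lambda>k. of_nat 1 / of_nat (den l k)", OF conjI])
      (simp add: den_approx of_rat_divide)
qed

lemma of_nat_computable: "real n \<in> computable_reals"
proof -
  have "computable_rat_seq (\<lambda>k. of_nat n / of_nat 1)"
    by (rule computable_rat_seq_quotient) (auto intro: programmable_const)
  then show ?thesis
    unfolding computable_reals_def mem_Collect_eq
    by (rule exI[of _ "\<lambda>k. of_nat n / of_nat 1", OF conjI]) simp
qed

lemma computable_real_seq_of_nat: "computable_real_seq (\<lambda>l. real n)"
proof -
  have "computable_rat_double_seq (\<lambda>l k. of_nat n / of_nat 1)"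
    by (rule computable_rat_double_seq_quotient) (auto intro: programmable_const)
  then show ?thesis
    unfolding computable_real_seq_def
    by (rule exI[of _ "\<lambda>l k. of_nat n / of_nat 1", OF conjI]) simp
qed

lemma computable_points_Pair:
  "(x, y) \<in> computable_points \<longleftrightarrow> x \<in> computable_points \<and> y \<in> computable_points"
  by (simp add: computable_points_def Basis_prod_def ball_Un)

lemma computable_points_vec:
  "x \<in> computable_points \<longleftrightarrow> (\<forall>i. x $ i \<in> computable_points)"
  by (auto simp: computable_points_def Basis_vec_def inner_axis)

lemma computable_points_real: "(x :: real) \<in> computable_points \<longleftrightarrow> x \<in> computable_reals"
  by (simp add: computable_points_def)

lemma computable_seq_Pair:
  "computable_seq (\<lambda>l. (x l, y l)) \<longleftrightarrow> computable_seq x \<and> computable_seq y"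
  by (simp add: computable_seq_def Basis_prod_def ball_Un)

lemma computable_seq_vec:
  "computable_seq x \<longleftrightarrow> (\<forall>i. computable_seq (\<lambda>l. x l $ i))"
  by (auto simp: computable_seq_def Basis_vec_def inner_axis)

lemma computable_seq_real: "computable_seq x \<longleftrightarrow> computable_real_seq x"
  by (simp add: computable_seq_def)

section \<open>Non-computability of linear programming\<close>

definition lp_instance ::
    "'n \<Rightarrow> 'm \<Rightarrow> real \<Rightarrow> (real^'n^'m) \<times> (real^'m) \<times> (real^'n)" where
  "lp_instance j i a =
     (\<chi> i' j'. if i' = i \<and> j' = j then a else 0, \<chi> i'. 1, \<chi> j'. if j' = j then 1 else 0)"

lemma lp_instance_computable: "lp_instance j i (halting_real l) \<in> computable_points"
  using halting_real_computable of_nat_computable[of 0] of_nat_computable[of 1]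
  by (simp add: lp_instance_def computable_points_Pair computable_points_vec computable_points_real)

lemma computable_seq_lp_instance: "computable_seq (\<lambda>l. lp_instance j i (halting_real l))"
proof -
  note const = computable_real_seq_of_nat[of 0] computable_real_seq_of_nat[of 1]
  have "computable_real_seq (\<lambda>l. if b then halting_real l else 0)" for b
    using computable_real_seq_halting_real const by (cases b) simp_all
  then show ?thesis
    using const
    by (simp add: lp_instance_def computable_seq_Pair computable_seq_vec computable_seq_real)
qed

text \<open>Row \<open>i\<close> says that coordinate \<open>j\<close> is at most \<open>N\<close>,
  and every other row reads \<open>0 \<le> 1\<close>. With \<open>a = 1 / N\<close> the optimal
  value is a natural number, so a computable maximizer exists.\<close>

lemma Opt_lp_instance:
  fixes A :: "real^'n^'m"
  assumes "lp_instance j i (1 / real N) = (A, y, c)" "N > 0"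
  shows "Opt A y c \<noteq> {}" "x \<in> Opt A y c \<Longrightarrow> x $ j = real N"
proof -
  have A: "(A *v x) $ i' = (if i' = i then x $ j / real N else 0)" for x i'
    using assms by (auto simp: lp_instance_def matrix_vector_mult_def if_distrib[of "\<lambda>a. a * _"]
        cong: if_cong)
  have y: "y $ i' = 1" for i' using assms by (auto simp: lp_instance_def)
  have c: "c \<bullet> x = x $ j" for x
    using assms by (auto simp: lp_instance_def inner_vec_def if_distrib[of "\<lambda>a. a * _"]
        cong: if_cong)
  have feasible: "x \<in> feasible A y \<longleftrightarrow> x \<in> computable_points \<and> x $ j \<le> real N" for x
    using assms(2) by (auto simp: feasible_def A y divide_le_eq)
  define x0 :: "real^'n" where "x0 = (\<chi> j'. if j' = j then real N else 0)"
  have x0: "x0 \<in> feasible A y" "x0 $ j = real N"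
    using of_nat_computable[of 0] of_nat_computable[of N]
    by (auto simp: x0_def feasible computable_points_vec computable_points_real)
  then have "x0 \<in> Opt A y c" by (simp add: Opt_def c feasible)
  then show "Opt A y c \<noteq> {}" by blast
  show "x $ j = real N" if "x \<in> Opt A y c"
    using that x0 by (force simp: Opt_def c feasible)
qed

text \<open>Covers both claims at once: a maximizer function has distance 0 from a maximizer, and a
  function uniformly within \<open>\<alpha> < 1/2\<close> of it satisfies the same
  assumption.\<close>

lemma not_banach_mazur_computable_near_maximizer:
  fixes G' :: "(real^'n^'m) \<times> (real^'m) \<times> (real^'n) \<Rightarrow> real^'n"
  assumes near: "\<And>A y c. (A, y, c) \<in> computable_points \<Longrightarrow> Opt A y c \<noteq> {} \<Longrightarrow>
    \<exists>x\<in>Opt A y c. norm (x - G' (A, y, c)) < 1 / 2"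
  shows "\<not> banach_mazur_computable G'"
proof
  assume BM: "banach_mazur_computable G'"
  \<comment> \<open>Any column and row will do; index types are nonempty.\<close>
  define j :: 'n where "j = undefined"
  define i :: 'm where "i = undefined"
  have "computable_seq (\<lambda>l. G' (lp_instance j i (halting_real l)))"
    using lp_instance_computable computable_seq_lp_instance
    by (intro BM[unfolded banach_mazur_computable_def, rule_format]) auto
  then have "computable_real_seq (\<lambda>l. G' (lp_instance j i (halting_real l)) $ j)"
    by (simp add: computable_seq_vec computable_seq_real)
  then obtain r where r: "computable_rat_double_seq r"
      "\<And>l k. \<bar>of_rat (r l k) - G' (lp_instance j i (halting_real l)) $ j\<bar> \<le> 1 / 2 ^ k"
    unfolding computable_real_seq_def by blast
  then obtain s p q where p: "recursive2 p" and q: "\<And>l k. q l k \<noteq> 0"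
    and r': "\<And>l k. r l k = (- 1) ^ s l k * (of_nat (p l k) / of_nat (q l k))"
    unfolding computable_rat_double_seq_def by blast
  obtain l t where t: "halted l t" "\<forall>s<t. \<not> halted l s" "p l 0 \<le> l + t"
    using diagonal_machine[OF p] by blast
  define N :: nat where "N = 2 ^ (l + t + 3)"
  have lim: "halting_real l = 1 / real N" using halting_real_halted[OF t(1,2)] by (simp add: N_def)
  obtain A y c where Ayc: "lp_instance j i (halting_real l) = (A, y, c)" by (metis prod_cases3)
  note opt = Opt_lp_instance[OF Ayc[unfolded lim]]
  have "N > 0" by (simp add: N_def)
  have "(A, y, c) \<in> computable_points" using lp_instance_computable[of j i l] Ayc by simp
  then obtain x where x: "x \<in> Opt A y c" "norm (x - G' (A, y, c)) < 1 / 2"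
    using near opt(1) \<open>N > 0\<close> by blast
  have "real N - G' (A, y, c) $ j < 1 / 2"
    using component_le_norm_cart[of "x - G' (A, y, c)" j] x opt(2)[OF \<open>N > 0\<close> x(1)] by simp
  \<comment> \<open>Precision \<open>k = 0\<close> suffices: the approximation error is at most
    1.\<close>
  moreover have "G' (A, y, c) $ j \<le> of_rat (r l 0) + 1"
    using r(2)[of l 0] by (simp add: Ayc)
  \<comment> \<open>The sign cannot raise the value, and the denominator is at least 1.\<close>
  moreover have "of_rat (r l 0) \<le> real (p l 0)"
  proof -
    have "\<bar>of_rat (r l 0)\<bar> = real (p l 0) / real (q l 0)"
      by (simp add: r' of_rat_mult of_rat_divide of_rat_power abs_mult power_abs)
    also have "\<dots> \<le> real (p l 0) / 1"
      using q[of l 0] by (intro divide_left_mono) auto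
    finally show ?thesis by linarith
  qed
  ultimately have "real N < real (p l 0) + 2" by simp
  \<comment> \<open>The summand 3 in the exponent leaves room for the total error below 2:
    \<open>N < p l 0 + 2 \<le> l + t + 2\<close> is impossible.\<close>
  moreover have "l + t + 3 < N" unfolding N_def by (rule less_exp)
  ultimately show False using t(3) by linarith
qed

text \<open>Infeasible or unbounded programs have no maximizer, so the condition on \<open>G\<close>
  is imposed where \<open>Opt\<close> is nonempty; imposed everywhere, it would be
  contradictory.\<close>

theorem theorem7:
  fixes G :: "(real^'n^'m) \<times> (real^'m) \<times> (real^'n) \<Rightarrow> real^'n"
  assumes "G \<in> computable_points \<rightarrow> computable_points"
    and "\<And>A y c. (A, y, c) \<in> computable_points \<Longrightarrow> Opt A y c \<noteq> {} \<Longrightarrow> G (A, y, c) \<in> Opt A y c"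
  shows "\<not> banach_mazur_computable G \<and>
    (\<forall>G' \<alpha>. G' \<in> computable_points \<rightarrow> computable_points \<and>
       sup_dist G G' \<le> ereal \<alpha> \<and> \<alpha> < 1/2 \<longrightarrow> \<not> banach_mazur_computable G')"
proof (intro conjI allI impI)
  show "\<not> banach_mazur_computable G"
    by (rule not_banach_mazur_computable_near_maximizer) (use assms(2) in fastforce)
next
  fix G' \<alpha>
  assume *: "G' \<in> computable_points \<rightarrow> computable_points \<and>
    sup_dist G G' \<le> ereal \<alpha> \<and> \<alpha> < 1/2"
  have near: "norm (G z - G' z) < 1/2" if "z \<in> computable_points" for z
  proof -
    have "ereal (norm (G z - G' z)) \<le> sup_dist G G'"
      unfolding sup_dist_def using that by (rule SUP_upper)
    then have "ereal (norm (G z - G' z)) \<le> ereal \<alpha>" using * by (metis order_trans)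
    then show ?thesis using * by simp
  qed
  show "\<not> banach_mazur_computable G'"
    by (rule not_banach_mazur_computable_near_maximizer) (use assms(2) near in blast)
qed

end
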